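(* Let $r\ge 2$ and $\ell\ge r+1$ be integers, and let $F=K_{a_1,\ldots,a_r}$ be an almost balanced complete $r$-partite graph on $\ell=a_1+\cdots+a_r$ vertices. Let $m=m_{r,\ell}$. Then for every integer $k\ge r$, \[ i_{k+1}(F)=\begin{cases}\kappa_F\cdot\frac{(k-1)_{r-1}}{k^{\ell-1}}, & \text{if } k\in[r,m-1],\\[.3em] \kappa_F\cdot\frac{(m-1)_{r-1}}{m^{\ell-1}}, & \text{if } k\ge m.\end{cases} \]
   Context: For graphs $F,G$, $I(F,G)$ denotes the number of induced copies of $F$ in $G$ (subsets $S\subseteq V(G)$ with $|S|=v(F)$ and $G[S]\cong F$). For an integer $k\ge 1$, $I_{k+1}(F,n)$ is the maximum of $I(F,G)$ over all $n$-vertex graphs $G$ containing no (not necessarily induced) copy of the complete graph $K_{k+1}$, and $i_{k+1}(F)=\lim_{n\to\infty}I_{k+1}(F,n)/\binom{n}{v(F)}$. $K_{a_1,\ldots,a_r}$ denotes the complete $r$-partite graph with part sizes $a_1\ge\cdots\ge a_r\ge 1$; it is almost balanced if it is not a complete graph and $\binom{a_1-a_r}{2}<a_r$. For an integer $z$ and positive integer $k$, $(z)_k=z(z-1)\cdots(z-k+1)$ if $z>k-1$ and $(z)_k=0$ otherwise. $\kappa_F=\frac{\ell!}{a_1!\cdots a_r!\cdot \mathrm{sym}(a_1,\ldots,a_r)}$, where $\mathrm{sym}(a_1,\ldots,a_r)=r_1!\cdots r_t!$ if the distinct values among $a_1,\ldots,a_r$ occur with multiplicities $r_1,\ldots,r_t$.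 $m_{r,\ell}$ is the unique integer $k\ge r$ maximizing $f(k)=\frac{(k-1)(k-2)\cdots(k-r+1)}{k^{\ell-1}}$ over all integers $k\ge r$. *)

theory Defs
  imports Complex_Main
begin

definition is_graph :: "'a set \<Rightarrow> 'a set set \<Rightarrow> bool" where
  "is_graph V E \<longleftrightarrow> (\<forall>e\<in>E. e \<subseteq> V \<and> card e = 2)"

definition induced_iso :: "'a set \<Rightarrow> 'a set set \<Rightarrow> 'b set \<Rightarrow> 'b set set \<Rightarrow> bool" where
  "induced_iso S E VF EF \<longleftrightarrow>
     (\<exists>f. bij_betw f S VF \<and> (\<forall>x\<in>S. \<forall>y\<in>S. {x, y} \<in> E \<longleftrightarrow> {f x, f y} \<in> EF))"

definition induced_count :: "'b set \<Rightarrow> 'b set set \<Rightarrow> 'a set \<Rightarrow> 'a set set \<Rightarrow> nat" where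
  "induced_count VF EF V E =
     card {S. S \<subseteq> V \<and> card S = card VF \<and> induced_iso S E VF EF}"

definition contains_clique :: "nat \<Rightarrow> 'a set \<Rightarrow> 'a set set \<Rightarrow> bool" where
  "contains_clique s V E \<longleftrightarrow>
     (\<exists>S\<subseteq>V. card S = s \<and> (\<forall>x\<in>S. \<forall>y\<in>S. x \<noteq> y \<longrightarrow> {x, y} \<in> E))"

definition I_max :: "nat \<Rightarrow> 'b set \<Rightarrow> 'b set set \<Rightarrow> nat \<Rightarrow> nat" where
  "I_max s VF EF n =
     Max {induced_count VF EF {..<n} E | E.
            is_graph {..<n} E \<and> \<not> contains_clique s {..<n} E}"

definition cmp_verts :: "nat list \<Rightarrow> (nat \<times> nat) set" where
  "cmp_verts a = {(j, t). j < length a \<and> t < a ! j}"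

definition cmp_edges :: "nat list \<Rightarrow> (nat \<times> nat) set set" where
  "cmp_edges a = {{x, y} | x y. x \<in> cmp_verts a \<and> y \<in> cmp_verts a \<and> fst x \<noteq> fst y}"

text \<open>Almost balanced: not complete and binom(a_1 - a_r, 2) < a_r (a sorted nonincreasingly).\<close>
definition almost_balanced :: "nat list \<Rightarrow> bool" where
  "almost_balanced a \<longleftrightarrow> sum_list a \<noteq> length a \<and> (hd a - last a) choose 2 < last a"

definition sym_parts :: "nat list \<Rightarrow> nat" where
  "sym_parts a = (\<Prod>v\<in>set a. fact (count_list a v))"

definition kappa :: "nat list \<Rightarrow> real" where
  "kappa a = real (fact (sum_list a)) / (real (prod_list (map fact a)) * real (sym_parts a))"

definition falling :: "int \<Rightarrow> nat \<Rightarrow> real" where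
  "falling z k = (if z > int k - 1 then (\<Prod>i<k. real_of_int (z - int i)) else 0)"

definition f_rl :: "nat \<Rightarrow> nat \<Rightarrow> nat \<Rightarrow> real" where
  "f_rl r l k = (\<Prod>i\<in>{1..<r}. (real k - real i)) / real k ^ (l - 1)"

definition m_rl :: "nat \<Rightarrow> nat \<Rightarrow> nat" where
  "m_rl r l = (THE k. r \<le> k \<and> (\<forall>j. r \<le> j \<longrightarrow> f_rl r l j \<le> f_rl r l k))"

end

theory Submission
  imports Defs "HOL-Analysis.Analysis" "HOL-Real_Asymp.Real_Asymp"
begin

text \<open>
  For a host graph, weight each vertex and count, with the induced weights, the maps of the
  pattern into the host that preserve adjacency and non-adjacency. As a function of the weights of
  two non-adjacent host vertices with fixed sum, this polynomial lies below its chord, so all weight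
  may be moved to a clique, as in the Motzkin--Straus argument; the clique has at most \<open>k\<close> vertices.
  On a clique, let two weights be \<open>s (1 + t)\<close> and \<open>s (1 - t)\<close>. Almost balancedness yields
  that the polynomial is at most \<open>1 - t\<^sup>2\<close> times its value after equalising the two weights
  plus \<open>t\<^sup>2\<close> times its value after merging them into one vertex. Hence some maximiser has all
  its positive weights equal, to \<open>1 / j\<close> say, with value \<open>f(j)\<close>.
  Finally \<open>f\<close> is log-concave in \<open>1 / j\<close>, so the best \<open>j \<le> k\<close> is \<open>min k m\<close>, which
  the balanced complete \<open>j\<close>-partite graphs attain asymptotically.
\<close>

section \<open>A two-variable inequality\<close>

text \<open>The bound on \<open>(a_1 - a_r) choose 2\<close> serves a single purpose. If the two
  weights carry exponents \<open>p\<close> and \<open>p + d\<close>, symmetrising leaves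
  \<open>(1 - t^2) ^ p\<close> times the even part in \<open>t\<close> of
  \<open>(1 + t) ^ d\<close>. That even part is at most \<open>(1 + t^2) ^ (d choose 2)\<close>, so
  a spare factor \<open>1 - t^2\<close> survives when \<open>d choose 2 <= p - 1\<close>. The merged
  term is there for maps using only one of the two vertices: their contribution can drop when the
  weights are equalised. Merging keeps the weighting admissible, so at a maximiser its value may be
  replaced by the maximum. The upper bound counts non-injective maps as well. This makes the count
  an exactly homogeneous polynomial in the weights, so the bound holds for every
  \<open>n >= 1\<close> without error term; only the Turan lower bound loses lower-order terms.
  Labelled copies become vertex sets on division by the number of automorphisms, and
  \<open>kappa\<close> is \<open>l!\<close> over that number.\<close>

definition even_part :: "nat \<Rightarrow> real \<Rightarrow> real" where
  "even_part d t = ((1 + t) ^ d + (1 - t) ^ d) / 2"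

definition odd_part :: "nat \<Rightarrow> real \<Rightarrow> real" where
  "odd_part d t = ((1 + t) ^ d - (1 - t) ^ d) / 2"

lemma parts_0 [simp]: "even_part 0 t = 1" "odd_part 0 t = 0"
  by (simp_all add: even_part_def odd_part_def)

text \<open>These are the even and odd parts in \<open>t\<close> of \<open>(1 + t) ^ d\<close>.
  Multiplying by \<open>1 + t\<close> mixes them, which allows the bounds to be proved by induction
  on \<open>d\<close>.\<close>

lemma parts_Suc:
  "even_part (Suc d) t = even_part d t + t * odd_part d t"
  "odd_part (Suc d) t = odd_part d t + t * even_part d t"
  by (auto simp: even_part_def odd_part_def field_simps)

lemma even_part_nonneg: "\<bar>t\<bar> \<le> 1 \<Longrightarrow> 0 \<le> even_part d t"
  by (auto simp: even_part_def)

lemma odd_part_bounds: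
  assumes "\<bar>t\<bar> \<le> 1"
  shows "0 \<le> t * odd_part d t" "t * odd_part d t \<le> d * t\<^sup>2 * even_part d t"
proof -
  have "0 \<le> t * odd_part d t \<and> t * odd_part d t \<le> d * t\<^sup>2 * even_part d t"
  proof (induction d)
    case (Suc d)
    have e: "t * odd_part (Suc d) t = t * odd_part d t + t\<^sup>2 * even_part d t"
      unfolding parts_Suc by (simp add: power2_eq_square algebra_simps)
    have "t * odd_part (Suc d) t \<le> real (Suc d) * t\<^sup>2 * even_part d t"
      unfolding e using Suc by (simp add: algebra_simps)
    also have "\<dots> \<le> real (Suc d) * t\<^sup>2 * even_part (Suc d) t"
      unfolding parts_Suc using Suc by (intro mult_left_mono) auto
    finally show ?case
      unfolding e using Suc even_part_nonneg[OF assms, of d] by auto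
  qed simp
  then show "0 \<le> t * odd_part d t" "t * odd_part d t \<le> d * t\<^sup>2 * even_part d t"
    by blast+
qed

text \<open>The step from \<open>d\<close> to \<open>d + 1\<close> costs a factor of at most
  \<open>1 + d * t^2\<close>, hence at most \<open>(1 + t^2) ^ d\<close>. The exponents 0, 1, ...,
  \<open>d - 1\<close> add up to \<open>d choose 2\<close>: this is where the binomial of the
  balance condition comes from.\<close>

lemma even_part_le_power:
  assumes "\<bar>t\<bar> \<le> 1"
  shows "even_part d t \<le> (1 + t\<^sup>2) ^ (d choose 2)"
proof (induction d)
  case (Suc d)
  have "even_part (Suc d) t \<le> (1 + d * t\<^sup>2) * even_part d t"
    unfolding parts_Suc using odd_part_bounds(2)[OF assms, of d] by (simp add: algebra_simps)
  also have "\<dots> \<le> (1 + t\<^sup>2) ^ d * (1 + t\<^sup>2) ^ (d choose 2)"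
  proof (intro mult_mono Suc.IH even_part_nonneg assms)
    show "1 + d * t\<^sup>2 \<le> (1 + t\<^sup>2) ^ d"
      using Bernoulli_inequality[of "t\<^sup>2" d] by (smt (verit) zero_le_power2)
  qed auto
  also have "\<dots> = (1 + t\<^sup>2) ^ (Suc d choose 2)"
    by (simp add: numeral_2_eq_2 power_add)
  finally show ?case .
qed simp

text \<open>The even part has nonnegative coefficients as a polynomial in \<open>t^2\<close>, so it
  is convex in \<open>t^2\<close> and lies below its chord from \<open>t = 0\<close> to
  \<open>t = 1\<close>. The term \<open>0 ^ p\<close> is the value of \<open>(1 - t) ^ p\<close> at
  \<open>t = 1\<close>.\<close>

lemma even_part_le_chord:
  assumes "\<bar>t\<bar> \<le> 1"
  shows "2 * even_part p t \<le> (1 - t\<^sup>2) * 2 + t\<^sup>2 * (2 ^ p + 0 ^ p)"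
proof (cases p)
  case 0 then show ?thesis by simp
next
  case (Suc n)
  have t2: "t\<^sup>2 \<le> 1" using assms by (simp add: abs_square_le_1)
  \<comment> \<open>The first two bounds are carried along to show that the increment
    \<open>t * odd_part (Suc n) t\<close> is at most \<open>t^2 * 2 ^ n\<close>, exactly what
    doubling the power in the third bound allows.\<close>
  have "even_part (Suc n) t \<le> 2 ^ n \<and> t * odd_part (Suc n) t \<le> t\<^sup>2 * 2 ^ n
      \<and> even_part (Suc n) t \<le> 1 - t\<^sup>2 + t\<^sup>2 * 2 ^ n"
  proof (induction n)
    case 0 show ?case by (simp add: parts_Suc power2_eq_square)
  next
    case (Suc n)
    have e: "t * odd_part (Suc (Suc n)) t = t * odd_part (Suc n) t + t\<^sup>2 * even_part (Suc n) t"
      unfolding parts_Suc(2)[of "Suc n"] by (simp add: power2_eq_square algebra_simps)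
    have 1: "t * odd_part (Suc n) t \<le> 2 ^ n"
      using Suc mult_right_mono[OF t2, of "2 ^ n"] by (smt (verit) mult_1 zero_le_power)
    have 2: "t\<^sup>2 * even_part (Suc n) t \<le> t\<^sup>2 * 2 ^ n"
      using Suc by (intro mult_left_mono) auto
    have 3: "t\<^sup>2 * 2 ^ Suc n = t\<^sup>2 * 2 ^ n + t\<^sup>2 * 2 ^ n" by simp
    show ?case
      unfolding e 3 parts_Suc(1)[of "Suc n"] using 1 2 Suc by auto
  qed
  then show ?thesis using Suc by (simp add: algebra_simps)
qed

text \<open>Factoring out \<open>(1 - t^2) ^ p\<close> leaves the even part for
  \<open>d = q - p\<close>. As \<open>d choose 2 <= p - 1\<close>, its bound pairs with
  \<open>p - 1\<close> of these factors into powers of \<open>1 - t^4\<close>, and one factor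
  \<open>1 - t^2\<close> remains.\<close>

lemma balanced_pair_le:
  fixes t :: real
  assumes "\<bar>t\<bar> \<le> 1" "p \<le> q" "(q - p) choose 2 < p"
  shows "(1 + t) ^ p * (1 - t) ^ q + (1 - t) ^ p * (1 + t) ^ q \<le> (1 - t\<^sup>2) * 2"
proof -
  define d where "d = q - p"
  have q: "q = p + d" using assms d_def by auto
  have t2: "t\<^sup>2 \<le> 1" using assms by (simp add: abs_square_le_1)
  obtain n where n: "p = Suc n" using assms(3) by (cases p) auto
  have "(1 + t) ^ p * (1 - t) ^ q + (1 - t) ^ p * (1 + t) ^ q
      = ((1 + t) * (1 - t)) ^ p * (2 * even_part d t)"
    unfolding q power_add power_mult_distrib even_part_def by (simp add: algebra_simps)
  also have "\<dots> = (1 - t\<^sup>2) ^ p * (2 * even_part d t)"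
    by (simp add: power2_eq_square algebra_simps)
  also have "\<dots> \<le> (1 - t\<^sup>2) ^ p * (2 * (1 + t\<^sup>2) ^ n)"
  proof (intro mult_left_mono)
    have "(1 + t\<^sup>2) ^ (d choose 2) \<le> (1 + t\<^sup>2) ^ n"
      using assms(3) n by (intro power_increasing) (auto simp: d_def)
    then show "even_part d t \<le> (1 + t\<^sup>2) ^ n"
      using even_part_le_power[OF assms(1), of d] by linarith
  qed (use t2 in auto)
  also have "\<dots> = (1 - t\<^sup>2) * 2 * ((1 - t\<^sup>2) * (1 + t\<^sup>2)) ^ n"
    unfolding n power_mult_distrib by simp
  also have "\<dots> \<le> (1 - t\<^sup>2) * 2 * 1"
    using t2 by (intro mult_left_mono power_le_one mult_nonneg_nonneg) (auto simp: algebra_simps)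
  finally show ?thesis by simp
qed

text \<open>An exponent 0 encodes a vertex not used by the copy; this relies on \<^term>\<open>0 ^ 0 = 1\<close>.\<close>

lemma pair_chord:
  fixes s t :: real
  assumes "\<bar>t\<bar> \<le> 1" "0 \<le> s"
    and pq: "p = 0 \<or> q = 0 \<or> (max p q - min p q) choose 2 < min p q"
  shows "(s * (1 + t)) ^ p * (s * (1 - t)) ^ q + (s * (1 - t)) ^ p * (s * (1 + t)) ^ q
     \<le> (1 - t\<^sup>2) * (s ^ p * s ^ q + s ^ p * s ^ q)
        + t\<^sup>2 * ((2 * s) ^ p * 0 ^ q + 0 ^ p * (2 * s) ^ q)"
proof -
  have t2: "t\<^sup>2 \<le> 1" using assms by (simp add: abs_square_le_1)
  have "(1 + t) ^ p * (1 - t) ^ q + (1 - t) ^ p * (1 + t) ^ q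
      \<le> (1 - t\<^sup>2) * 2 + t\<^sup>2 * (2 ^ p * 0 ^ q + 0 ^ p * 2 ^ q)" (is "?L \<le> ?R")
  \<comment> \<open>If an exponent vanishes, only single powers are left and convexity suffices.
    Otherwise the merged term is zero and balancedness has to do all the work.\<close>
  proof (cases "p = 0 \<or> q = 0")
    case True
    then show ?thesis
      using even_part_le_chord[OF assms(1), of p] even_part_le_chord[OF assms(1), of q]
      by (auto simp: even_part_def algebra_simps add_divide_distrib)
  next
    case False
    then have "(max p q - min p q) choose 2 < min p q" using pq by auto
    then have "?L \<le> (1 - t\<^sup>2) * 2"
      using balanced_pair_le[OF assms(1), of p q] balanced_pair_le[OF assms(1), of q p]
      by (cases "p \<le> q") (auto simp: max_def min_def algebra_simps)
    then show ?thesis by (smt (verit) mult_nonneg_nonneg zero_le_power zero_le_power2)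
  qed
  then have "s ^ (p + q) * ?L \<le> s ^ (p + q) * ?R"
    using assms(2) by (intro mult_left_mono) auto
  moreover have z: "(2 * s) ^ p * 0 ^ q = s ^ (p + q) * (2 ^ p * 0 ^ q)"
      "0 ^ p * (2 * s) ^ q = s ^ (p + q) * (0 ^ p * 2 ^ q)"
    by (cases "p = 0"; cases "q = 0"; simp add: power_mult_distrib power_add)+
  moreover have "(s * (1 + t)) ^ p * (s * (1 - t)) ^ q + (s * (1 - t)) ^ p * (s * (1 + t)) ^ q
      = s ^ (p + q) * ?L"
    by (simp only: power_mult_distrib power_add) (simp only: algebra_simps)
  moreover have "(1 - t\<^sup>2) * (s ^ p * s ^ q + s ^ p * s ^ q)
        + t\<^sup>2 * (s ^ (p + q) * (2 ^ p * 0 ^ q) + s ^ (p + q) * (0 ^ p * 2 ^ q))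
      = s ^ (p + q) * ?R"
    unfolding power_add[symmetric] by (simp only: algebra_simps)
  ultimately show ?thesis by (simp only:)
qed

section \<open>Unimodality of \<open>f_rl\<close>\<close>

text \<open>Dividing each of the \<open>r - 1\<close> factors by \<open>k\<close> leaves
  \<open>k\<close> only through \<open>y = 1 / k\<close>; this is the form whose logarithm is
  concave.\<close>

lemma f_rl_eq:
  assumes "1 \<le> r" "r \<le> l" "r \<le> k"
  shows "f_rl r l k = (1 / real k) ^ (l - r) * (\<Prod>i\<in>{1..<r}. 1 - real i * (1 / real k))"
proof -
  have k: "real k > 0" using assms by simp
  have "(\<Prod>i\<in>{1..<r}. real k - real i) = (\<Prod>i\<in>{1..<r}. real k * (1 - real i * (1 / real k)))"
    using k by (intro prod.cong) (auto simp: field_simps)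
  also have "\<dots> = real k ^ (r - 1) * (\<Prod>i\<in>{1..<r}. 1 - real i * (1 / real k))"
    by (simp only: prod.distrib prod_constant card_atLeastLessThan)
  finally have *: "(\<Prod>i\<in>{1..<r}. real k - real i)
      = real k ^ (r - 1) * (\<Prod>i\<in>{1..<r}. 1 - real i * (1 / real k))" .
  have "l - 1 = (r - 1) + (l - r)" using assms by simp
  then have "real k ^ (l - 1) = real k ^ (r - 1) * real k ^ (l - r)"
    by (simp only: power_add)
  then show ?thesis unfolding f_rl_def * using k by (simp add: field_simps)
qed

lemma f_rl_pos:
  assumes "1 \<le> r" "r \<le> k"
  shows "f_rl r l k > 0"
  unfolding f_rl_def using assms by (intro divide_pos_pos prod_pos) auto

text \<open>Since \<open>l > r\<close>, at least one factor \<open>1 / k\<close> is left over. The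
  decay confines the search for a maximiser to finitely many \<open>k\<close>.\<close>

lemma f_rl_le_inverse:
  assumes "1 \<le> r" "r < l" "r \<le> k"
  shows "f_rl r l k \<le> 1 / real k"
proof -
  have k: "real k \<ge> 1" using assms by simp
  have "f_rl r l k \<le> (1 / real k) ^ (l - r) * 1"
    unfolding f_rl_eq[OF assms(1) less_imp_le[OF assms(2)] assms(3)]
    using assms by (intro mult_left_mono prod_le_1) (auto simp: field_simps)
  also have "\<dots> \<le> (1 / real k) ^ 1 * 1"
    using assms k by (intro mult_right_mono power_decreasing) auto
  finally show ?thesis by simp
qed

text \<open>In terms of \<open>y = 1 / k\<close> the function \<^const>\<open>f_rl\<close> is a product of positive affine
  functions, hence log-concave.\<close>

lemma f_rl_quasiconcave:
  assumes "1 \<le> r" "r \<le> l" "r \<le> j" "j \<le> k" "k \<le> n"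
  shows "min (f_rl r l j) (f_rl r l n) \<le> f_rl r l k"
proof -
  \<comment> \<open>\<open>g\<close> is the logarithm of \<open>f_rl\<close> extended to real
    \<open>y = 1 / k\<close>. On the interval used, every \<open>1 - i * y\<close> is positive
    because \<open>i < r <= j\<close>. Inversion reverses the order:
    \<open>1 / n <= 1 / k <= 1 / j\<close>.\<close>
  define g where "g = (\<lambda>y. real (l - r) * ln y + (\<Sum>i\<in>{1..<r}. ln (1 - real i * y)))"
  have pos: "1 - real i * y > 0" if "i \<in> {1..<r}" "y \<in> {1 / real n..1 / real j}" for i y
  proof -
    have "real i * y \<le> real i * (1 / real j)"
      using that by (intro mult_left_mono) auto
    also have "\<dots> < 1" using that assms by (auto simp: field_simps)
    finally show ?thesis by simp
  qed
  have ln: "u * ln x + v * ln y \<le> ln (u * x + v * y)"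
    if "x > 0" "y > 0" "u \<ge> 0" "v \<ge> 0" "u + v = 1" for x y u v :: real
    using ln_concave that unfolding concave_on_iff by (auto simp: real_scaleR_def)
  have conc: "concave_on {1 / real n..1 / real j} g"
    unfolding concave_on_iff
  proof (intro conjI ballI allI impI)
    fix x y u v :: real
    assume x: "x \<in> {1 / real n..1 / real j}" and y: "y \<in> {1 / real n..1 / real j}"
      and uv: "0 \<le> u" "0 \<le> v" "u + v = 1"
    have n0: "1 / real n > 0" using assms by simp
    then have "x > 0" "y > 0" using x y by (meson atLeastAtMost_iff less_le_trans)+
    have "u * (\<Sum>i\<in>{1..<r}. ln (1 - real i * x)) + v * (\<Sum>i\<in>{1..<r}. ln (1 - real i * y))
        = (\<Sum>i\<in>{1..<r}. u * ln (1 - real i * x) + v * ln (1 - real i * y))"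
      by (simp add: sum.distrib sum_distrib_left)
    also have "\<dots> \<le> (\<Sum>i\<in>{1..<r}. ln (1 - real i * (u * x + v * y)))"
    proof (rule sum_mono)
      fix i assume i: "i \<in> {1..<r}"
      have "1 - real i * (u * x + v * y) = u * (1 - real i * x) + v * (1 - real i * y)"
        using uv(3) by (simp add: algebra_simps)
      then show "u * ln (1 - real i * x) + v * ln (1 - real i * y)
          \<le> ln (1 - real i * (u * x + v * y))"
        using ln[OF pos[OF i x] pos[OF i y] uv] by simp
    qed
    finally have 1: "u * (\<Sum>i\<in>{1..<r}. ln (1 - real i * x)) + v * (\<Sum>i\<in>{1..<r}. ln (1 - real i * y))
        \<le> (\<Sum>i\<in>{1..<r}. ln (1 - real i * (u * x + v * y)))" .
    have "u * ln x + v * ln y \<le> ln (u * x + v * y)"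
      using \<open>x > 0\<close> \<open>y > 0\<close> uv by (intro ln)
    then have "real (l - r) * (u * ln x + v * ln y) \<le> real (l - r) * ln (u * x + v * y)"
      by (intro mult_left_mono) auto
    with 1 show "u * g x + v * g y \<le> g (u *\<^sub>R x + v *\<^sub>R y)"
      unfolding g_def real_scaleR_def by (simp add: algebra_simps)
  qed simp
  have gf: "g (1 / real p) = ln (f_rl r l p)" if "j \<le> p" "p \<le> n" for p
  proof -
    have p: "r \<le> p" "1 / real p \<in> {1 / real n..1 / real j}"
      using that assms by (auto simp: frac_le)
    have "(\<Prod>i\<in>{1..<r}. 1 - real i * (1 / real p)) > 0"
      using pos p by (intro prod_pos) blast
    moreover have "ln (\<Prod>i\<in>{1..<r}. 1 - real i * (1 / real p))
        = (\<Sum>i\<in>{1..<r}. ln (1 - real i * (1 / real p)))"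
      using pos p by (intro ln_prod) (auto dest: less_imp_neq)
    ultimately show ?thesis
      unfolding f_rl_eq[OF assms(1,2) p(1)] g_def using p assms
      by (subst ln_mult) (auto simp: ln_realpow)
  qed
  have "min (g (1 / real n)) (g (1 / real j)) \<le> g (1 / real k)"
    using assms by (intro concave_on_ge_min[OF conc]) (auto simp: frac_le)
  then have "min (ln (f_rl r l n)) (ln (f_rl r l j)) \<le> ln (f_rl r l k)"
    using assms by (simp only: gf)
  moreover have "f_rl r l n > 0" "f_rl r l j > 0" "f_rl r l k > 0"
    using assms by (auto intro!: f_rl_pos)
  ultimately show ?thesis by (auto simp: min_def split: if_splits)
qed

text \<open>Cancelling common factors turns equality into
  \<open>(k - r + 1) * (k + 1) ^ (l - 1) = k ^ l\<close>, impossible because \<open>k + 1\<close>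
  divides the left side and is coprime to the right one. This arithmetic makes the maximiser
  unique.\<close>

lemma f_rl_neq_Suc:
  assumes "2 \<le> r" "r < l" "r \<le> k"
  shows "f_rl r l k \<noteq> f_rl r l (Suc k)"
proof
  assume eq: "f_rl r l k = f_rl r l (Suc k)"
  define P where "P = (\<Prod>i\<in>{1..<r - 1}. real k - real i)"
  have P: "P \<noteq> 0" unfolding P_def using assms by (auto simp: prod_zero_iff)
  have k0: "real k \<noteq> 0" using assms by simp
  have "{1..<r} = insert (r - 1) {1..<r - 1}" using assms by auto
  then have a: "(\<Prod>i\<in>{1..<r}. real k - real i) = (real k - real (r - 1)) * P"
    unfolding P_def by (simp del: of_nat_diff)
  have "(\<Prod>i\<in>{1..<r}. real (Suc k) - real i) = (\<Prod>i\<in>{0..<r - 1}. real k - real i)"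
    using assms by (intro prod.reindex_bij_witness[of _ Suc "\<lambda>i. i - 1"]) auto
  also have "\<dots> = real k * P"
    unfolding P_def using assms by (subst prod.atLeast_Suc_lessThan) auto
  finally have b: "(\<Prod>i\<in>{1..<r}. real (Suc k) - real i) = real k * P" .
  have "(real k - real (r - 1)) * real (Suc k) ^ (l - 1) = real k * real k ^ (l - 1)"
    proof -
    have "P * ((real k - real (r - 1)) * real (Suc k) ^ (l - 1)) = P * (real k * real k ^ (l - 1))"
      using eq k0 unfolding f_rl_def a b
      by (simp add: field_simps del: of_nat_Suc of_nat_diff)
    then show ?thesis using P by (simp only: mult_cancel_left) simp
  qed
  also have "\<dots> = real k ^ l" using assms by (simp flip: power_Suc)
  finally have *: "(real k - real (r - 1)) * real (Suc k) ^ (l - 1) = real k ^ l" .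
  have "real k - real (r - 1) = real (k - (r - 1))"
    using assms by (intro of_nat_diff[symmetric]) auto
  with * have "real ((k - (r - 1)) * Suc k ^ (l - 1)) = real (k ^ l)"
    by (simp only: of_nat_mult of_nat_power)
  then have "(k - (r - 1)) * Suc k ^ (l - 1) = k ^ l"
    by (simp only: of_nat_eq_iff)
  then have "Suc k ^ (l - 1) dvd k ^ l" by (metis dvd_triv_right)
  moreover have "Suc k dvd Suc k ^ (l - 1)" using assms by (intro dvd_power) auto
  ultimately have "Suc k dvd k ^ l" by (rule dvd_trans[rotated])
  moreover have "coprime (Suc k) (k ^ l)" by simp
  ultimately have "is_unit (Suc k)" using coprime_absorb_left by blast
  then show False using assms by simp
qed

lemma m_rl_maximal:
  assumes "2 \<le> r" "r < l"
  shows "r \<le> m_rl r l" "\<And>j. r \<le> j \<Longrightarrow> f_rl r l j \<le> f_rl r l (m_rl r l)"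
proof -
  let ?max = "\<lambda>k. r \<le> k \<and> (\<forall>j. r \<le> j \<longrightarrow> f_rl r l j \<le> f_rl r l k)"
  have fr: "f_rl r l r > 0" using assms by (intro f_rl_pos) auto
  obtain N where N: "real N > 1 / f_rl r l r" using reals_Archimedean2 by blast
  have N': "f_rl r l j < f_rl r l r" if "j \<ge> N" "r \<le> j" for j
  proof -
    have "1 / f_rl r l r < real j" using N that by linarith
    then have "1 / real j < f_rl r l r" using fr that assms by (auto simp: field_simps)
    then show ?thesis using f_rl_le_inverse[of r l j] that assms by auto
  qed
  have rN: "r < N" using N'[of r] by (cases "r < N") auto
  obtain k where k: "k \<in> {r..N}" "\<forall>j\<in>{r..N}. f_rl r l j \<le> f_rl r l k"
  proof -
    have "Max (f_rl r l ` {r..N}) \<in> f_rl r l ` {r..N}"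
      using rN by (intro Max_in) auto
    then obtain k where "k \<in> {r..N}" "f_rl r l k = Max (f_rl r l ` {r..N})" by force
    then show ?thesis by (intro that[of k]) auto
  qed
  have max: "?max k"
  proof (intro conjI allI impI)
    fix j assume "r \<le> j"
    then show "f_rl r l j \<le> f_rl r l k"
      using N'[of j] k rN by (cases "j \<le> N") (force dest: bspec[of _ _ r])+
  qed (use k in auto)
  \<comment> \<open>\<open>m_rl\<close> is a definite description, so uniqueness is needed too.
    Between two maximisers \<open>k1 < k2\<close>, quasi-concavity would force equal values at
    \<open>k1\<close> and \<open>k1 + 1\<close>.\<close>
  have less: False if k1: "?max k1" and k2: "?max k2" and lt: "k1 < k2" for k1 k2
  proof -
    have "min (f_rl r l k1) (f_rl r l k2) \<le> f_rl r l (Suc k1)"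
      using k1 lt assms by (intro f_rl_quasiconcave) auto
    moreover have "f_rl r l k1 \<le> f_rl r l k2"
      using k1 k2 by blast
    moreover have "f_rl r l (Suc k1) \<le> f_rl r l k1"
      using k1 by (meson le_Suc_eq)
    moreover have "f_rl r l k1 \<noteq> f_rl r l (Suc k1)"
      using k1 assms by (intro f_rl_neq_Suc) auto
    ultimately show False by (simp add: min_def)
  qed
  have "?max (m_rl r l)"
    unfolding m_rl_def
  proof (rule theI[of ?max, OF max])
    fix x assume "?max x"
    note x = this
    have "\<not> x < k" by (rule notI) (rule less[OF x max])
    moreover have "\<not> k < x" by (rule notI) (rule less[OF max x])
    ultimately show "x = k" by linarith
  qed
  then show "r \<le> m_rl r l" "\<And>j. r \<le> j \<Longrightarrow> f_rl r l j \<le> f_rl r l (m_rl r l)" by auto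
qed

text \<open>Quasi-concavity against the global maximum makes \<open>f_rl\<close> nondecreasing up to
  \<open>m_rl r l\<close>; for larger \<open>k\<close> the maximum itself is the bound.\<close>

lemma f_rl_le_min:
  assumes "2 \<le> r" "r < l" "r \<le> j" "j \<le> k"
  shows "f_rl r l j \<le> f_rl r l (min k (m_rl r l))"
proof (cases "k \<le> m_rl r l")
  case True
  then show ?thesis
    using f_rl_quasiconcave[of r l j k "m_rl r l"] m_rl_maximal(2)[OF assms(1,2,3)] assms by auto
qed (use m_rl_maximal[OF assms(1,2)] assms in auto)

section \<open>Optimal part sizes\<close>

text \<open>Up to the factor \<open>kappa\<close>, the limit density of copies in a complete multipartite graph
  whose part sizes are in proportion \<open>x\<close>.\<close>

definition copy_poly :: "nat list \<Rightarrow> 'v set \<Rightarrow> ('v \<Rightarrow> real) \<Rightarrow> real" where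
  "copy_poly a K x =
     (\<Sum>\<tau>\<in>{\<tau> \<in> {..<length a} \<rightarrow>\<^sub>E K. inj_on \<tau> {..<length a}}. \<Prod>i<length a. x (\<tau> i) ^ (a ! i))"

text \<open>An order-free form of the balance condition: an injection may place any two parts on the
  two vertices being compared.\<close>

definition close_parts :: "nat list \<Rightarrow> bool" where
  "close_parts a \<longleftrightarrow> (\<forall>i<length a. \<forall>j<length a. i \<noteq> j \<longrightarrow>
     (max (a ! i) (a ! j) - min (a ! i) (a ! j)) choose 2 < min (a ! i) (a ! j))"

text \<open>Functions are forced to vanish off \<open>K\<close> so that, for finite
  \<open>K\<close>, this simplex is compact in the product topology on all functions.\<close>

definition weights :: "'v set \<Rightarrow> ('v \<Rightarrow> real) set" where
  "weights K = {x. (\<forall>i. 0 \<le> x i) \<and> (\<forall>i. i \<notin> K \<longrightarrow> x i = 0) \<and> sum x K = 1}"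

lemma finite_inj_maps [simp]:
  "finite A \<Longrightarrow> finite K \<Longrightarrow> finite {\<tau> \<in> A \<rightarrow>\<^sub>E K. P \<tau>}"
  by (simp add: finite_PiE)

text \<open>Composition with the transposition permutes the injections. This symmetry supplies the
  second summand of each pair handled by \<open>pair_chord\<close>.\<close>

lemma copy_poly_transpose:
  assumes "u \<in> K" "v \<in> K"
  shows "copy_poly a K (x \<circ> Transposition.transpose u v) = copy_poly a K x"
proof -
  let ?T = "{\<tau> \<in> {..<length a} \<rightarrow>\<^sub>E K. inj_on \<tau> {..<length a}}"
  define h where "h = (\<lambda>\<tau>::nat \<Rightarrow> 'a. restrict (Transposition.transpose u v \<circ> \<tau>) {..<length a})"
  have tK: "Transposition.transpose u v z \<in> K" if "z \<in> K" for z
    using assms that by (auto simp: Transposition.transpose_def)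
  have mem: "h \<tau> \<in> ?T" if "\<tau> \<in> ?T" for \<tau>
  proof -
    have "inj_on (Transposition.transpose u v \<circ> \<tau>) {..<length a}"
      using that by (intro comp_inj_on inj_on_subset[OF inj_transpose]) auto
    then show ?thesis using that tK by (auto simp: h_def PiE_iff inj_on_def)
  qed
  have inv: "h (h \<tau>) = \<tau>" if "\<tau> \<in> ?T" for \<tau>
    using that by (auto simp: h_def restrict_def fun_eq_iff PiE_iff extensional_def)
  show ?thesis
    unfolding copy_poly_def
    by (rule sum.reindex_bij_witness[of _ h h])
      (use mem inv in \<open>auto simp: h_def intro!: prod.cong\<close>)
qed

lemma prod_split_pair:
  fixes y :: "'v \<Rightarrow> real" and \<tau> :: "nat \<Rightarrow> 'v"
  assumes "u \<noteq> v"
  shows "(\<Prod>i<r. y (\<tau> i) ^ e i) = y u ^ (\<Sum>i | i < r \<and> \<tau> i = u. e i)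
     * y v ^ (\<Sum>i | i < r \<and> \<tau> i = v. e i) * (\<Prod>i | i < r \<and> \<tau> i \<noteq> u \<and> \<tau> i \<noteq> v. y (\<tau> i) ^ e i)"
proof -
  have "{..<r} = {i. i < r \<and> \<tau> i = u} \<union> ({i. i < r \<and> \<tau> i = v} \<union> {i. i < r \<and> \<tau> i \<noteq> u \<and> \<tau> i \<noteq> v})"
    by auto
  then have "(\<Prod>i<r. y (\<tau> i) ^ e i) = (\<Prod>i \<in> {i. i < r \<and> \<tau> i = u} \<union>
      ({i. i < r \<and> \<tau> i = v} \<union> {i. i < r \<and> \<tau> i \<noteq> u \<and> \<tau> i \<noteq> v}). y (\<tau> i) ^ e i)"
    by (rule arg_cong)
  also have "\<dots> = (\<Prod>i | i < r \<and> \<tau> i = u. y (\<tau> i) ^ e i)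
     * (\<Prod>i\<in>{i. i < r \<and> \<tau> i = v} \<union> {i. i < r \<and> \<tau> i \<noteq> u \<and> \<tau> i \<noteq> v}. y (\<tau> i) ^ e i)"
    using assms by (intro prod.union_disjoint) auto
  also have "(\<Prod>i\<in>{i. i < r \<and> \<tau> i = v} \<union> {i. i < r \<and> \<tau> i \<noteq> u \<and> \<tau> i \<noteq> v}. y (\<tau> i) ^ e i)
     = (\<Prod>i | i < r \<and> \<tau> i = v. y (\<tau> i) ^ e i)
     * (\<Prod>i | i < r \<and> \<tau> i \<noteq> u \<and> \<tau> i \<noteq> v. y (\<tau> i) ^ e i)"
    by (intro prod.union_disjoint) auto
  also have "(\<Prod>i | i < r \<and> \<tau> i = u. y (\<tau> i) ^ e i) = y u ^ (\<Sum>i | i < r \<and> \<tau> i = u. e i)"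
    by (simp add: power_sum)
  also have "(\<Prod>i | i < r \<and> \<tau> i = v. y (\<tau> i) ^ e i) = y v ^ (\<Sum>i | i < r \<and> \<tau> i = v. e i)"
    by (simp add: power_sum)
  finally show ?thesis by (simp only: mult.assoc)
qed

lemma copy_poly_chord:
  assumes "close_parts a" "finite K" "u \<in> K" "v \<in> K" "u \<noteq> v" "\<And>i. 0 \<le> x i"
    and xu: "x u = s * (1 + t)" and xv: "x v = s * (1 - t)" and st: "0 \<le> s" "\<bar>t\<bar> \<le> 1"
  shows "copy_poly a K x \<le> (1 - t\<^sup>2) * copy_poly a K (x(u := s, v := s))
      + t\<^sup>2 * copy_poly a K (x(u := 2 * s, v := 0))"
proof -
  let ?r = "length a"
  define T where "T = {\<tau> \<in> {..<?r} \<rightarrow>\<^sub>E K. inj_on \<tau> {..<?r}}"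
  define e where "e = (\<lambda>(w::'a) \<tau>. \<Sum>i | i < ?r \<and> \<tau> i = w. a ! i)"
  define R where "R = (\<lambda>\<tau>. \<Prod>i | i < ?r \<and> \<tau> i \<noteq> u \<and> \<tau> i \<noteq> v. x (\<tau> i) ^ (a ! i))"
  \<comment> \<open>Averaging with the transposed weights gives the symmetric two-term form. It is
    stated for every \<open>y\<close> agreeing with \<open>x\<close> off \<open>u\<close> and
    \<open>v\<close>, so one cofactor \<open>R\<close> serves all three weightings.\<close>
  have sym: "2 * copy_poly a K y
      = (\<Sum>\<tau>\<in>T. (y u ^ e u \<tau> * y v ^ e v \<tau> + y v ^ e u \<tau> * y u ^ e v \<tau>) * R \<tau>)"
    if y: "\<And>w. w \<noteq> u \<Longrightarrow> w \<noteq> v \<Longrightarrow> y w = x w" for y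
  proof -
    have w: "copy_poly a K z = (\<Sum>\<tau>\<in>T. z u ^ e u \<tau> * z v ^ e v \<tau> * R \<tau>)"
      if z: "\<And>w. w \<noteq> u \<Longrightarrow> w \<noteq> v \<Longrightarrow> z w = x w" for z
      unfolding copy_poly_def T_def[symmetric] e_def R_def
      by (subst prod_split_pair[OF assms(5)]) (auto simp: z intro!: sum.cong prod.cong)
    have "2 * copy_poly a K y = copy_poly a K y + copy_poly a K (y \<circ> Transposition.transpose u v)"
      using copy_poly_transpose[OF assms(3,4), of a y] by simp
    also have "\<dots> = (\<Sum>\<tau>\<in>T. y u ^ e u \<tau> * y v ^ e v \<tau> * R \<tau>)
        + (\<Sum>\<tau>\<in>T. y v ^ e u \<tau> * y u ^ e v \<tau> * R \<tau>)"
      using w[of y] w[of "y \<circ> Transposition.transpose u v"] y by (simp add: Transposition.transpose_def)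
    finally show ?thesis by (simp only: sum.distrib ring_distribs)
  qed
  have "2 * copy_poly a K x \<le> (\<Sum>\<tau>\<in>T. (1 - t\<^sup>2) * ((s ^ e u \<tau> * s ^ e v \<tau> + s ^ e u \<tau> * s ^ e v \<tau>) * R \<tau>)
       + t\<^sup>2 * (((2 * s) ^ e u \<tau> * 0 ^ e v \<tau> + 0 ^ e u \<tau> * (2 * s) ^ e v \<tau>) * R \<tau>))"
  proof (subst sym, simp, rule sum_mono)
    fix \<tau> assume \<tau>: "\<tau> \<in> T"
    have R: "R \<tau> \<ge> 0" unfolding R_def using assms(6) by (intro prod_nonneg) auto
    have single: "e w \<tau> = a ! i" if "i < ?r" "\<tau> i = w" for i w
    proof -
      have "{i. i < ?r \<and> \<tau> i = w} = {i}"
        using that \<tau> by (auto simp: T_def inj_on_def)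
      then show ?thesis by (simp add: e_def)
    qed
    have "e u \<tau> = 0 \<or> e v \<tau> = 0
        \<or> (max (e u \<tau>) (e v \<tau>) - min (e u \<tau>) (e v \<tau>)) choose 2 < min (e u \<tau>) (e v \<tau>)"
    proof (cases "\<exists>i<?r. \<exists>j<?r. \<tau> i = u \<and> \<tau> j = v")
      case True
      then obtain i j where "i < ?r" "j < ?r" "\<tau> i = u" "\<tau> j = v" by blast
      moreover from this have "i \<noteq> j" using assms(5) by auto
      ultimately show ?thesis using assms(1) single[of i u] single[of j v]
        unfolding close_parts_def by metis
    next
      case False
      then have "{i. i < ?r \<and> \<tau> i = u} = {} \<or> {i. i < ?r \<and> \<tau> i = v} = {}" by blast
      then show ?thesis unfolding e_def by fastforce
    qed
    from mult_right_mono[OF pair_chord[OF st(2,1) this] R]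
    show "(x u ^ e u \<tau> * x v ^ e v \<tau> + x v ^ e u \<tau> * x u ^ e v \<tau>) * R \<tau>
      \<le> (1 - t\<^sup>2) * ((s ^ e u \<tau> * s ^ e v \<tau> + s ^ e u \<tau> * s ^ e v \<tau>) * R \<tau>)
       + t\<^sup>2 * (((2 * s) ^ e u \<tau> * 0 ^ e v \<tau> + 0 ^ e u \<tau> * (2 * s) ^ e v \<tau>) * R \<tau>)"
      unfolding xu xv by (simp only: mult.assoc ring_distribs)
  qed
  also have "\<dots> = (1 - t\<^sup>2) * (2 * copy_poly a K (x(u := s, v := s)))
      + t\<^sup>2 * (2 * copy_poly a K (x(u := 2 * s, v := 0)))"
    using assms(5) by (subst (1 2) sym) (auto simp: sum.distrib sum_distrib_left)
  finally show ?thesis by simp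
qed

section \<open>Compactness and special values of the copy polynomial\<close>

lemma continuous_on_copy_poly: "continuous_on UNIV (copy_poly a K)"
  unfolding copy_poly_def[abs_def]
  by (intro continuous_intros continuous_on_product_coordinates)

lemma compact_weights:
  assumes "finite K"
  shows "compact (weights K)"
proof -
  have "compact (PiE UNIV (\<lambda>i. if i \<in> K then {0..1::real} else {0}))"
    using compactin_PiE[of "\<lambda>i. euclidean" UNIV "\<lambda>i. if i \<in> K then {0..1::real} else {0}"]
    by (simp add: euclidean_product_topology)
  moreover have "closed {x::_ \<Rightarrow> real. sum x K = 1}"
    by (intro closed_Collect_eq continuous_intros continuous_on_product_coordinates)
  ultimately have "compact (PiE UNIV (\<lambda>i. if i \<in> K then {0..1::real} else {0}) \<inter> {x. sum x K = 1})"
    by (rule compact_Int_closed)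
  also have "PiE UNIV (\<lambda>i. if i \<in> K then {0..1::real} else {0}) \<inter> {x. sum x K = 1} = weights K"
    (is "?L = ?R")
  proof
    show "?R \<subseteq> ?L"
    proof
      fix x assume x: "x \<in> ?R"
      have "x i \<le> 1" if "i \<in> K" for i
        using x member_le_sum[of i K x] that assms unfolding weights_def by auto
      then show "x \<in> ?L" using x by (auto simp: weights_def)
    qed
    show "?L \<subseteq> ?R"
      by (auto simp: weights_def PiE_iff split: if_splits) (metis atLeastAtMost_iff singletonD order_refl)
  qed
  finally show ?thesis .
qed

lemma card_inj_maps:
  assumes "finite A" "finite K"
  shows "card {\<tau> \<in> A \<rightarrow>\<^sub>E K. inj_on \<tau> A} = (\<Prod>i<card A. card K - i)"
  using card_inj_on_subset_funcset[OF assms order_refl]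
  by (simp add: atLeast0LessThan)

text \<open>With \<open>j = card K\<close>, each injection has weight \<open>1 / j ^ l\<close> and
  their number is a falling factorial of \<open>j\<close>; cancelling its leading factor
  \<open>j\<close> gives \<open>f_rl\<close>.\<close>

lemma copy_poly_uniform:
  assumes "finite K" "\<And>i. i \<in> K \<Longrightarrow> x i = 1 / real (card K)"
    and "1 \<le> length a" "length a \<le> card K" "1 \<le> sum_list a"
  shows "copy_poly a K x = f_rl (length a) (sum_list a) (card K)"
proof -
  let ?r = "length a" and ?j = "card K"
  have "copy_poly a K x = (\<Sum>\<tau>\<in>{\<tau> \<in> {..<?r} \<rightarrow>\<^sub>E K. inj_on \<tau> {..<?r}}. (1 / real ?j) ^ sum_list a)"
    unfolding copy_poly_def
  proof (rule sum.cong)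
    fix \<tau> assume "\<tau> \<in> {\<tau> \<in> {..<?r} \<rightarrow>\<^sub>E K. inj_on \<tau> {..<?r}}"
    then have "(\<Prod>i<?r. x (\<tau> i) ^ (a ! i)) = (\<Prod>i<?r. (1 / real ?j) ^ (a ! i))"
      using assms(2) by (intro prod.cong) (auto simp: PiE_iff)
    also have "\<dots> = (1 / real ?j) ^ sum_list a"
      by (simp add: power_sum sum_list_sum_nth atLeast0LessThan)
    finally show "(\<Prod>i<?r. x (\<tau> i) ^ (a ! i)) = (1 / real ?j) ^ sum_list a" .
  qed simp
  also have "\<dots> = real (\<Prod>i<?r. ?j - i) * (1 / real ?j) ^ sum_list a"
    using assms(1) by (simp add: card_inj_maps)
  also have "real (\<Prod>i<?r. ?j - i) = (\<Prod>i<?r. real ?j - real i)"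
    unfolding of_nat_prod using assms(4) by (intro prod.cong) auto
  also have "\<dots> = real ?j * (\<Prod>i\<in>{1..<?r}. real ?j - real i)"
    using prod.atLeast_Suc_lessThan[of 0 ?r "\<lambda>i. real ?j - real i"] assms(3)
    by (cases a) (auto simp: lessThan_atLeast0)
  also have "(1 / real ?j) ^ sum_list a = 1 / real ?j * (1 / real ?j ^ (sum_list a - 1))"
    using assms(5) by (cases "sum_list a") (auto simp: power_one_over)
  finally show ?thesis
    using assms(3,4) by (simp add: f_rl_def)
qed

lemma copy_poly_zero:
  assumes "finite K" "card K < length a"
  shows "copy_poly a K x = 0"
proof -
  have "{\<tau> \<in> {..<length a} \<rightarrow>\<^sub>E K. inj_on \<tau> {..<length a}} = {}"
    using assms card_inj[of _ "{..<length a}" K] by (force simp: PiE_iff)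
  then show ?thesis unfolding copy_poly_def by (simp only: sum.empty)
qed

text \<open>As every part is nonempty, an injection that leaves \<open>J\<close> meets a positive
  power of 0; an empty part would contribute \<open>0 ^ 0 = 1\<close>.\<close>

lemma copy_poly_support:
  assumes "finite K" "J \<subseteq> K" "\<And>i. i \<in> K - J \<Longrightarrow> x i = 0" "\<And>i. i < length a \<Longrightarrow> 1 \<le> a ! i"
  shows "copy_poly a K x = copy_poly a J x"
  unfolding copy_poly_def
proof (rule sum.mono_neutral_right)
  show "\<forall>\<tau>\<in>{\<tau> \<in> {..<length a} \<rightarrow>\<^sub>E K. inj_on \<tau> {..<length a}}
        - {\<tau> \<in> {..<length a} \<rightarrow>\<^sub>E J. inj_on \<tau> {..<length a}}. (\<Prod>i<length a. x (\<tau> i) ^ (a ! i)) = 0"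
  proof
    fix \<tau> assume "\<tau> \<in> {\<tau> \<in> {..<length a} \<rightarrow>\<^sub>E K. inj_on \<tau> {..<length a}}
        - {\<tau> \<in> {..<length a} \<rightarrow>\<^sub>E J. inj_on \<tau> {..<length a}}"
    then obtain i where "i < length a" "\<tau> i \<in> K - J" by (auto simp: PiE_iff)
    then show "(\<Prod>i<length a. x (\<tau> i) ^ (a ! i)) = 0"
      using assms(3)[of "\<tau> i"] assms(4)[of i] by (auto intro!: prod_zero bexI[of _ i] simp: power_0_left)
  qed
qed (use assms finite_inj_maps[of "{..<length a}" K] in \<open>auto simp: PiE_iff\<close>)

text \<open>Among the maximisers choose one of least Euclidean norm: balancing two distinct positive
  weights would produce a maximiser of smaller norm.\<close>

lemma copy_poly_le:
  assumes a: "close_parts a" "1 \<le> length a" "\<And>i. i < length a \<Longrightarrow> 1 \<le> a ! i"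
    and K: "finite K" and x: "x \<in> weights K"
    and B: "0 \<le> B" "\<And>j. length a \<le> j \<Longrightarrow> j \<le> card K \<Longrightarrow> f_rl (length a) (sum_list a) j \<le> B"
  shows "copy_poly a K x \<le> B"
proof -
  obtain z where z: "z \<in> weights K" "\<And>w. w \<in> weights K \<Longrightarrow> copy_poly a K w \<le> copy_poly a K z"
    using continuous_attains_sup[OF compact_weights[OF K] _ continuous_on_subset[OF continuous_on_copy_poly]] x
    by blast
  define Z where "Z = weights K \<inter> {w. copy_poly a K w = copy_poly a K z}"
  have "compact Z"
    unfolding Z_def
    by (intro compact_Int_closed compact_weights K closed_Collect_eq continuous_on_copy_poly continuous_intros)
  moreover have "z \<in> Z" unfolding Z_def using z by simp
  moreover have "continuous_on Z (\<lambda>w. \<Sum>i\<in>K. (w i)\<^sup>2)"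
    by (rule continuous_on_subset[of UNIV])
      (auto intro!: continuous_intros continuous_on_product_coordinates)
  ultimately obtain y where y: "y \<in> Z" "\<And>w. w \<in> Z \<Longrightarrow> (\<Sum>i\<in>K. (y i)\<^sup>2) \<le> (\<Sum>i\<in>K. (w i)\<^sup>2)"
    using continuous_attains_inf[of Z "\<lambda>w. \<Sum>i\<in>K. (w i)\<^sup>2"] by blast
  have yW: "\<And>i. 0 \<le> y i" "\<And>i. i \<notin> K \<Longrightarrow> y i = 0" "sum y K = 1"
    and yz: "copy_poly a K y = copy_poly a K z"
    using y(1) by (auto simp: Z_def weights_def)
  have split: "sum g K = g u + (g v + sum g (K - {u, v}))"
    if "u \<in> K" "v \<in> K" "u \<noteq> v" for u v and g :: "'a \<Rightarrow> real"
  proof -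
    have "K - {u, v} = K - {u} - {v}" by auto
    then show ?thesis using that K by (simp add: sum.remove[of K u] sum.remove[of "K - {u}" v])
  qed
  have eq: "y u = y v" if uv: "u \<in> K" "v \<in> K" "0 < y u" "0 < y v" for u v
  proof (rule ccontr)
    assume ne: "y u \<noteq> y v"
    then have "u \<noteq> v" by auto
    define s t where "s = (y u + y v) / 2" and "t = (y u - y v) / (y u + y v)"
    have s: "s > 0" and t: "\<bar>t\<bar> < 1" "t \<noteq> 0" using uv ne by (auto simp: s_def t_def field_simps)
    have yu: "y u = s * (1 + t)" and yv: "y v = s * (1 - t)"
      using uv unfolding s_def t_def by (auto simp: field_simps)
    have t2: "0 < t\<^sup>2" "t\<^sup>2 < 1" using t by (auto simp: abs_square_less_1)
    let ?b = "y(u := s, v := s)" and ?c = "y(u := 2 * s, v := 0)"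
    have off: "sum (y(u := p, v := q)) (K - {u, v}) = sum y (K - {u, v})" for p q
      by (intro sum.cong) auto
    have bc: "?b \<in> weights K" "?c \<in> weights K"
      using yW s uv \<open>u \<noteq> v\<close> split[OF uv(1,2) \<open>u \<noteq> v\<close>, of y]
      by (auto simp: weights_def split[OF uv(1,2) \<open>u \<noteq> v\<close>] off yu yv algebra_simps)
    have "copy_poly a K y \<le> (1 - t\<^sup>2) * copy_poly a K ?b + t\<^sup>2 * copy_poly a K ?c"
      using a K uv \<open>u \<noteq> v\<close> yW yu yv s t by (intro copy_poly_chord) auto
    \<comment> \<open>The merged weighting only has to be no better than the maximum. Subtracting
      leaves a factor \<open>1 - t^2 > 0\<close>, since both weights are positive, so the equalised
      weighting is again a maximiser.\<close>
    moreover have "t\<^sup>2 * copy_poly a K ?c \<le> t\<^sup>2 * copy_poly a K y"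
      using z(2)[OF bc(2)] t2 unfolding yz by (intro mult_left_mono) auto
    ultimately have "(1 - t\<^sup>2) * copy_poly a K y \<le> (1 - t\<^sup>2) * copy_poly a K ?b"
      by (simp add: algebra_simps)
    then have "copy_poly a K y \<le> copy_poly a K ?b" using t2 by simp
    then have "?b \<in> Z" using bc(1) z(2)[OF bc(1)] yz by (auto simp: Z_def)
    from y(2)[OF this] have "(\<Sum>i\<in>K. (y i)\<^sup>2) \<le> (\<Sum>i\<in>K. (?b i)\<^sup>2)" .
    moreover have "(\<Sum>i\<in>K - {u, v}. (?b i)\<^sup>2) = (\<Sum>i\<in>K - {u, v}. (y i)\<^sup>2)"
      by (intro sum.cong) auto
    ultimately have "(y u)\<^sup>2 + (y v)\<^sup>2 \<le> s\<^sup>2 + s\<^sup>2"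
      using \<open>u \<noteq> v\<close> by (simp add: split[OF uv(1,2) \<open>u \<noteq> v\<close>])
    moreover have "(y u)\<^sup>2 + (y v)\<^sup>2 = s\<^sup>2 + s\<^sup>2 + 2 * (s\<^sup>2 * t\<^sup>2)"
      unfolding yu yv by (simp add: power2_eq_square algebra_simps)
    ultimately show False using s t2 by (simp add: mult_le_0_iff not_le)
  qed
  define J where "J = {u \<in> K. 0 < y u}"
  have J: "finite J" "J \<subseteq> K" using K by (auto simp: J_def)
  have "y i = 0" if "i \<in> K - J" for i using that yW(1)[of i] by (auto simp: J_def)
  then have yJ: "copy_poly a K y = copy_poly a J y" and sJ: "sum y J = 1"
    using J K a(3) yW(3) by (auto intro!: copy_poly_support simp: sum.mono_neutral_left[of K J])
  have yu: "y u = 1 / real (card J)" if "u \<in> J" for u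
  proof -
    have "sum y J = (\<Sum>i\<in>J. y u)" using eq that by (intro sum.cong) (auto simp: J_def)
    then have "y u * real (card J) = 1" using sJ by (simp add: mult.commute)
    then show ?thesis by (metis mult_zero_right nonzero_eq_divide_eq zero_neq_one)
  qed
  have l: "1 \<le> sum_list a"
    using a(2) a(3)[of 0] by (cases a) auto
  have "copy_poly a J y \<le> B"
  proof (cases "length a \<le> card J")
    case True
    then show ?thesis
      using copy_poly_uniform[OF J(1) yu a(2) _ l] B(2) card_mono[OF K J(2)] by auto
  qed (use copy_poly_zero[OF J(1)] B(1) in auto)
  then show ?thesis using z(2)[OF x] yz yJ by simp
qed

section \<open>Reduction to weights on a clique\<close>

text \<open>Non-adjacent vertices may be identified, so that \<open>hom_poly\<close> counts copies in weighted
  blow-ups of the host.\<close>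

definition hom_maps :: "nat list \<Rightarrow> 'v set \<Rightarrow> 'v set set \<Rightarrow> (nat \<times> nat \<Rightarrow> 'v) set" where
  "hom_maps a V E = {\<phi> \<in> cmp_verts a \<rightarrow>\<^sub>E V.
     \<forall>w\<in>cmp_verts a. \<forall>z\<in>cmp_verts a. {\<phi> w, \<phi> z} \<in> E \<longleftrightarrow> fst w \<noteq> fst z}"

definition hom_poly :: "nat list \<Rightarrow> 'v set \<Rightarrow> 'v set set \<Rightarrow> ('v \<Rightarrow> real) \<Rightarrow> real" where
  "hom_poly a V E x = (\<Sum>\<phi>\<in>hom_maps a V E. \<Prod>w\<in>cmp_verts a. x (\<phi> w))"

lemma cmp_verts_Sigma: "cmp_verts a = Sigma {..<length a} (\<lambda>i. {..<a ! i})"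
  by (auto simp: cmp_verts_def)

lemma finite_cmp_verts [simp]: "finite (cmp_verts a)"
  by (simp add: cmp_verts_Sigma)

lemma card_cmp_verts: "card (cmp_verts a) = sum_list a"
  by (simp add: cmp_verts_Sigma sum_list_sum_nth atLeast0LessThan)

lemma finite_hom_maps [simp]: "finite V \<Longrightarrow> finite (hom_maps a V E)"
  by (simp add: hom_maps_def)

lemma singleton_not_edge: "is_graph V E \<Longrightarrow> {p} \<notin> E"
  by (auto simp: is_graph_def)

text \<open>Pattern vertices sent into \<open>{u, v}\<close> have pairwise non-adjacent images,
  hence lie in one part and have the same neighbours. Moving them all to a vertex that one of them
  already occupies preserves every adjacency.\<close>

lemma hom_maps_collapse:
  assumes "is_graph V E" "{u, v} \<notin> E" "\<phi> \<in> hom_maps a V E"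
    and "w0 \<in> cmp_verts a" "\<phi> w0 \<in> {u, v}"
  shows "restrict (\<lambda>w. if \<phi> w \<in> {u, v} then \<phi> w0 else \<phi> w) (cmp_verts a) \<in> hom_maps a V E"
proof -
  let ?P = "cmp_verts a"
  have \<phi>: "{\<phi> w, \<phi> z} \<in> E \<longleftrightarrow> fst w \<noteq> fst z" if "w \<in> ?P" "z \<in> ?P" for w z
    using assms(3) that by (auto simp: hom_maps_def)
  have nE: "{p, q} \<notin> E" if "p \<in> {u, v}" "q \<in> {u, v}" for p q
    using that assms(2) singleton_not_edge[OF assms(1)] by (auto simp: insert_commute)
  have same: "fst w = fst w0" if "w \<in> ?P" "\<phi> w \<in> {u, v}" for w
    using \<phi>[OF that(1) assms(4)] nE[OF that(2) assms(5)] by auto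
  have "{if \<phi> w \<in> {u, v} then \<phi> w0 else \<phi> w, if \<phi> z \<in> {u, v} then \<phi> w0 else \<phi> z} \<in> E
      \<longleftrightarrow> fst w \<noteq> fst z" if "w \<in> ?P" "z \<in> ?P" for w z
    using \<phi>[OF that] \<phi>[OF that(1) assms(4)] \<phi>[OF assms(4) that(2)] nE[OF assms(5,5)]
      same[OF that(1)] same[OF that(2)] by (cases "\<phi> w \<in> {u, v}"; cases "\<phi> z \<in> {u, v}") simp_all
  moreover have "\<phi> w \<in> V" if "w \<in> ?P" for w using assms(3) that by (auto simp: hom_maps_def)
  ultimately show ?thesis using assms(4) by (simp add: hom_maps_def)
qed

lemma prod_le_scaled:
  fixes f g :: "'b \<Rightarrow> real"
  assumes "finite P" "w0 \<in> P" "\<And>w. w \<in> P \<Longrightarrow> 0 \<le> f w \<and> f w \<le> g w" "f w0 = c * g w0" "0 \<le> c"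
  shows "prod f P \<le> c * prod g P"
proof -
  have "prod f P = f w0 * prod f (P - {w0})" "prod g P = g w0 * prod g (P - {w0})"
    by (rule prod.remove[OF assms(1,2)])+
  moreover have "prod f (P - {w0}) \<le> prod g (P - {w0})"
    using assms by (intro prod_mono) auto
  moreover have "0 \<le> c * g w0" using assms(2,3,4) by metis
  ultimately show ?thesis using assms(4) by (simp add: mult_left_mono flip: mult.assoc)
qed

text \<open>Group the maps by their collapse identifying \<open>v\<close> with \<open>u\<close>. A group either contains all
  maps with the given collapse, or at most one of them.\<close>

lemma hom_poly_merge:
  assumes "finite V" "is_graph V E" "u \<in> V" "v \<in> V" "u \<noteq> v" "{u, v} \<notin> E"
    and x: "\<And>i. 0 \<le> x i" and c: "0 \<le> c" "c \<le> 1" "x u = c * s" "x v = (1 - c) * s"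
  shows "hom_poly a V E x \<le> c * hom_poly a V E (x(u := s, v := 0))
      + (1 - c) * hom_poly a V E (x(u := 0, v := s))"
proof -
  define P where "P = cmp_verts a"
  define H where "H = hom_maps a V E"
  define wt where "wt = (\<lambda>(y :: 'a \<Rightarrow> real) \<phi>. \<Prod>w\<in>P. y (\<phi> w))"
  \<comment> \<open>\<open>col p\<close> sends all of \<open>{u, v}\<close> to \<open>p\<close>. For
    a \<open>\<phi>\<close> that meets \<open>{u, v}\<close>, membership in \<open>H\<close> is
    guaranteed only when \<open>p\<close> is a value that \<open>\<phi>\<close> takes.\<close>
  define col where "col = (\<lambda>p \<phi>. restrict (\<lambda>w. if \<phi> w \<in> {u, v} then p else \<phi> w) P)"
  define G where "G = (\<lambda>\<xi>. {\<phi> \<in> H. col u \<phi> = \<xi>})"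
  define x1 x2 where "x1 = x(u := s, v := 0)" and "x2 = x(u := 0, v := s)"
  have finP: "finite P" and finH: "finite H" using assms(1) by (auto simp: P_def H_def)
  have s: "0 \<le> s"
  proof -
    have "x u + x v = s" using c by (simp add: algebra_simps)
    then show ?thesis using x[of u] x[of v] by simp
  qed
  have x12: "0 \<le> x1 i" "0 \<le> x2 i" for i using x s by (auto simp: x1_def x2_def)
  have wt0: "0 \<le> wt y \<phi>" if "\<And>i. 0 \<le> y i" for y \<phi>
    unfolding wt_def using that by (intro prod_nonneg) auto
  have HV: "\<phi> w \<in> V" if "\<phi> \<in> H" "w \<in> P" for \<phi> w
    using that by (auto simp: H_def hom_maps_def P_def)
  have Hext: "\<phi> \<in> extensional P" if "\<phi> \<in> H" for \<phi>
    using that by (auto simp: H_def hom_maps_def P_def PiE_iff)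
  have collapse: "col (\<phi> w) \<phi> \<in> H" if "\<phi> \<in> H" "w \<in> P" "\<phi> w \<in> {u, v}" for \<phi> w
    using hom_maps_collapse[OF assms(2,6), of \<phi> a w] that unfolding H_def col_def P_def by simp
  have col_id: "col p \<phi> = \<phi>" if "\<phi> \<in> H" "\<And>w. w \<in> P \<Longrightarrow> \<phi> w \<in> {u, v} \<Longrightarrow> \<phi> w = p" for p \<phi>
    using Hext[OF that(1)] that(2) by (auto simp: col_def restrict_def fun_eq_iff extensional_def)
  have group: "hom_poly a V E y = (\<Sum>\<xi>\<in>col u ` H. sum (wt y) (G \<xi>))" for y
    unfolding hom_poly_def G_def H_def[symmetric] P_def[symmetric] wt_def
    by (rule sum.group[symmetric]) (use finH in auto)
  have single: "wt y \<phi> \<le> sum (wt y) (G \<xi>)" if "\<phi> \<in> G \<xi>" "\<And>i. 0 \<le> y i" for y \<phi> \<xi>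
    using that finH by (intro member_le_sum wt0) (auto simp: G_def)
  have "sum (wt x) (G \<xi>) \<le> c * sum (wt x1) (G \<xi>) + (1 - c) * sum (wt x2) (G \<xi>)" if \<xi>: "\<xi> \<in> col u ` H" for \<xi>
  proof -
    obtain \<psi> where \<psi>: "\<psi> \<in> H" "\<xi> = col u \<psi>" using \<xi> by blast
    define \<xi>' where "\<xi>' = col v \<psi>"
    have colcol: "col p (col q \<phi>) = col p \<phi>" if "q \<in> {u, v}" for p q \<phi>
      using that by (auto simp: col_def restrict_def fun_eq_iff)
    have G_col: "col p \<phi> = col p \<psi>" if "\<phi> \<in> G \<xi>" for \<phi> p
    proof -
      have "col u \<phi> = col u \<psi>" using that \<psi> by (simp add: G_def)
      then have "col p (col u \<phi>) = col p (col u \<psi>)" by simp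
      then show ?thesis by (simp add: colcol)
    qed
    have \<xi>V: "\<xi> w \<noteq> v" "\<xi> w \<in> V" "\<xi>' w \<noteq> u" "\<xi>' w \<in> V" if "w \<in> P" for w
      using that \<psi> HV[OF \<psi>(1) that] assms(3,4,5) by (auto simp: \<xi>'_def col_def)
    have \<xi>G: "\<xi> \<in> G \<xi>" if "\<xi> \<in> H" using that by (simp add: G_def \<psi>(2) colcol)
    have \<xi>'G: "\<xi>' \<in> G \<xi>" if "\<xi>' \<in> H" using that by (simp add: G_def \<psi>(2) \<xi>'_def colcol)
    have wt12: "wt x2 \<xi>' = wt x1 \<xi>"
      unfolding wt_def using assms(5)
      by (intro prod.cong) (auto simp: \<xi>'_def \<psi>(2) col_def x1_def x2_def)
    have nonneg: "0 \<le> sum (wt x1) (G \<xi>)" "0 \<le> sum (wt x2) (G \<xi>)"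
      using x12 by (auto intro!: sum_nonneg wt0)
    show ?thesis
    proof (cases "\<xi> \<in> H \<and> \<xi>' \<in> H")
      case True
      \<comment> \<open>Adjacency may be forgotten here: the sum over all lifts of
        \<open>\<xi>\<close> factors, and each position holding \<open>u\<close> contributes
        \<open>x u + x v = s\<close>.\<close>
      have GPi: "G \<xi> \<subseteq> PiE P (\<lambda>w. {z \<in> V. (if z = v then u else z) = \<xi> w})"
      proof
        fix \<phi> assume \<phi>: "\<phi> \<in> G \<xi>"
        then have "\<phi> \<in> H" "\<xi> = col u \<phi>" by (auto simp: G_def)
        then show "\<phi> \<in> PiE P (\<lambda>w. {z \<in> V. (if z = v then u else z) = \<xi> w})"
          using HV Hext by (auto simp: PiE_iff col_def)
      qed
      have "sum (wt x) (G \<xi>) \<le> sum (wt x) (PiE P (\<lambda>w. {z \<in> V. (if z = v then u else z) = \<xi> w}))"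
        using GPi x finP assms(1) by (intro sum_mono2 finite_PiE wt0) auto
      also have "\<dots> = (\<Prod>w\<in>P. \<Sum>z | z \<in> V \<and> (if z = v then u else z) = \<xi> w. x z)"
        unfolding wt_def using finP assms(1) by (intro prod_sum_PiE[symmetric]) auto
      also have "\<dots> = wt x1 \<xi>"
        unfolding wt_def
      proof (rule prod.cong)
        fix w assume w: "w \<in> P"
        have "{z \<in> V. (if z = v then u else z) = \<xi> w} = (if \<xi> w = u then {u, v} else {\<xi> w})"
          using \<xi>V[OF w] assms(3,4) by auto
        then show "(\<Sum>z | z \<in> V \<and> (if z = v then u else z) = \<xi> w. x z) = x1 (\<xi> w)"
          using \<xi>V[OF w] assms(5) c by (auto simp: x1_def algebra_simps)
      qed simp
      also have "\<dots> = c * wt x1 \<xi> + (1 - c) * wt x2 \<xi>'" by (simp add: wt12 algebra_simps)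
      also have "\<dots> \<le> c * sum (wt x1) (G \<xi>) + (1 - c) * sum (wt x2) (G \<xi>)"
        using c True \<xi>G \<xi>'G x12 by (intro add_mono mult_left_mono single) auto
      finally show ?thesis .
    next
      case False
      \<comment> \<open>A value attained in \<open>{u, v}\<close> yields a collapse in
        \<open>H\<close>. So if one of the two collapses is not in \<open>H\<close>, every map of
        the group avoids the vertex it collapses to.\<close>
      have all: "\<phi> w = p" if \<phi>: "\<phi> \<in> G \<xi>" and w: "w \<in> P" "\<phi> w \<in> {u, v}"
        and p: "p = u \<and> \<xi>' \<notin> H \<or> p = v \<and> \<xi> \<notin> H" for \<phi> w p
      proof -
        have "col (\<phi> w) \<psi> \<in> H" using collapse[of \<phi> w] G_col[OF \<phi>, of "\<phi> w"] \<phi> w by (auto simp: G_def)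
        then show ?thesis using p w \<psi>(2) by (auto simp: \<xi>'_def)
      qed
      show ?thesis
      proof (cases "\<xi>' \<in> H")
        case False
        have "G \<xi> \<subseteq> {\<xi>}"
        proof
          fix \<phi> assume \<phi>: "\<phi> \<in> G \<xi>"
          have "col u \<phi> = \<phi>"
          proof (rule col_id)
            show "\<phi> \<in> H" using \<phi> by (simp add: G_def)
            show "\<phi> w = u" if "w \<in> P" "\<phi> w \<in> {u, v}" for w
              using all[OF \<phi> that] False by blast
          qed
          moreover have "col u \<phi> = \<xi>" using \<phi> by (simp add: G_def)
          ultimately show "\<phi> \<in> {\<xi>}" by simp
        qed
        moreover have "\<psi> \<in> G \<xi>" using \<psi> by (simp add: G_def)
        ultimately have "G \<xi> = {\<xi>}" by blast
        then have "\<xi> \<in> G \<xi>" by simp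
        then have \<xi>H: "\<xi> \<in> H" by (simp only: G_def mem_Collect_eq)
        \<comment> \<open>If \<open>u\<close> did not occur, both collapses would coincide and lie
          in \<open>H\<close>. So \<open>u\<close> occurs, and one occurrence supplies the factor
          \<open>c\<close>.\<close>
        have "\<exists>w0\<in>P. \<xi> w0 = u"
        proof (rule ccontr)
          assume "\<not> ?thesis"
          then have "\<xi> w \<notin> {u, v}" if "w \<in> P" for w using \<xi>V[OF that] that by blast
          then have "col v \<xi> = \<xi>" by (intro col_id \<xi>H) auto
          moreover have "col v \<xi> = \<xi>'" by (simp add: \<psi>(2) \<xi>'_def colcol)
          ultimately show False using False \<xi>H by simp
        qed
        then obtain w0 where w0: "w0 \<in> P" "\<xi> w0 = u" by blast
        have "c * s \<le> 1 * s" using c s by (intro mult_right_mono)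
        then have "wt x \<xi> \<le> c * wt x1 \<xi>"
          unfolding wt_def using w0 \<xi>V x c assms(5)
          by (intro prod_le_scaled[OF finP w0(1)]) (auto simp: x1_def)
        also have "\<dots> \<le> c * sum (wt x1) (G \<xi>)"
          using c \<xi>G[OF \<xi>H] x12 by (intro mult_left_mono single) auto
        finally show ?thesis using \<open>G \<xi> = {\<xi>}\<close> nonneg c by (auto intro: add_increasing2)
      next
        case True
        then have nH: "\<xi> \<notin> H" using False by auto
        have "G \<xi> \<subseteq> {\<xi>'}"
        proof
          fix \<phi> assume \<phi>: "\<phi> \<in> G \<xi>"
          have "col v \<phi> = \<phi>"
          proof (rule col_id)
            show "\<phi> \<in> H" using \<phi> by (simp add: G_def)
            show "\<phi> w = v" if "w \<in> P" "\<phi> w \<in> {u, v}" for w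
              using all[OF \<phi> that] nH by blast
          qed
          then show "\<phi> \<in> {\<xi>'}" using G_col[OF \<phi>, of v] by (simp add: \<xi>'_def)
        qed
        then have G: "G \<xi> = {\<xi>'}" using \<xi>'G[OF True] by auto
        have "\<exists>w0\<in>P. \<xi>' w0 = v"
        proof (rule ccontr)
          assume "\<not> ?thesis"
          then have "\<xi>' w \<notin> {u, v}" if "w \<in> P" for w using \<xi>V[OF that] that by blast
          then have "col u \<xi>' = \<xi>'" by (intro col_id True) auto
          moreover have "col u \<xi>' = \<xi>" by (simp add: \<psi>(2) \<xi>'_def colcol)
          ultimately show False using nH True by simp
        qed
        then obtain w0 where w0: "w0 \<in> P" "\<xi>' w0 = v" by blast
        have "(1 - c) * s \<le> 1 * s" using c s by (intro mult_right_mono) auto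
        then have "wt x \<xi>' \<le> (1 - c) * wt x2 \<xi>'"
          unfolding wt_def using w0 \<xi>V x c assms(5)
          by (intro prod_le_scaled[OF finP w0(1)]) (auto simp: x2_def)
        also have "\<dots> \<le> (1 - c) * sum (wt x2) (G \<xi>)"
          using c \<xi>'G[OF True] x12 by (intro mult_left_mono single) auto
        finally show ?thesis using G nonneg c by (auto intro: add_increasing)
      qed
    qed
  qed
  then have "hom_poly a V E x
      \<le> (\<Sum>\<xi>\<in>col u ` H. c * sum (wt x1) (G \<xi>) + (1 - c) * sum (wt x2) (G \<xi>))"
    unfolding group by (rule sum_mono)
  also have "\<dots> = c * hom_poly a V E x1 + (1 - c) * hom_poly a V E x2"
    unfolding group by (simp add: sum.distrib sum_distrib_left)
  finally show ?thesis by (simp only: x1_def x2_def)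
qed

lemma weights_shift:
  assumes "finite V" "x \<in> weights V" "u \<in> V" "v \<in> V" "u \<noteq> v" "0 \<le> p" "0 \<le> q" "p + q = x u + x v"
  shows "x(u := p, v := q) \<in> weights V"
proof -
  have split: "sum g V = g u + (g v + sum g (V - {u} - {v}))" for g :: "'a \<Rightarrow> real"
    using assms by (simp add: sum.remove[of V u] sum.remove[of "V - {u}" v])
  have "sum (x(u := p, v := q)) (V - {u} - {v}) = sum x (V - {u} - {v})"
    by (intro sum.cong) auto
  then show ?thesis
    using assms split[of x] split[of "x(u := p, v := q)"] by (auto simp: weights_def)
qed

text \<open>The value is at most a weighted mean of the two merged values, so one of these is no
  smaller. Either merger drops a vertex from the support, whence the induction on its size.\<close>

lemma hom_poly_clique_support:
  assumes "finite V" "is_graph V E" "x \<in> weights V"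
  obtains y where "y \<in> weights V" "hom_poly a V E x \<le> hom_poly a V E y"
    "\<And>u v. 0 < y u \<Longrightarrow> 0 < y v \<Longrightarrow> u \<noteq> v \<Longrightarrow> {u, v} \<in> E"
proof -
  have "\<exists>y\<in>weights V. hom_poly a V E x \<le> hom_poly a V E y
      \<and> (\<forall>u v. 0 < y u \<longrightarrow> 0 < y v \<longrightarrow> u \<noteq> v \<longrightarrow> {u, v} \<in> E)"
    using assms(3)
  proof (induction "card {i \<in> V. 0 < x i}" arbitrary: x rule: less_induct)
    case less
    show ?case
    proof (cases "\<forall>u v. 0 < x u \<longrightarrow> 0 < x v \<longrightarrow> u \<noteq> v \<longrightarrow> {u, v} \<in> E")
      case False
      then obtain u v where uv: "0 < x u" "0 < x v" "u \<noteq> v" "{u, v} \<notin> E" by blast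
      then have V: "u \<in> V" "v \<in> V" using less.prems by (force simp: weights_def)+
      define s where "s = x u + x v"
      define c where "c = x u / s"
      have s: "s > 0" using uv by (simp add: s_def)
      have c: "0 \<le> c" "c \<le> 1" "x u = c * s" "x v = (1 - c) * s"
        using uv s by (auto simp: c_def s_def field_simps)
      let ?x1 = "x(u := s, v := 0)" and ?x2 = "x(u := 0, v := s)"
      have W: "?x1 \<in> weights V" "?x2 \<in> weights V"
        using assms(1) less.prems V uv s by (auto intro!: weights_shift simp: s_def)
      have 1: "card {i \<in> V. 0 < ?x1 i} < card {i \<in> V. 0 < x i}"
        using uv V assms(1) by (intro psubset_card_mono) auto
      have 2: "card {i \<in> V. 0 < ?x2 i} < card {i \<in> V. 0 < x i}"
        using uv V assms(1) by (intro psubset_card_mono) auto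
      have le: "hom_poly a V E x \<le> c * hom_poly a V E ?x1 + (1 - c) * hom_poly a V E ?x2"
        using less.prems by (intro hom_poly_merge assms V uv c) (auto simp: weights_def)
      have "hom_poly a V E x \<le> hom_poly a V E ?x1 \<or> hom_poly a V E x \<le> hom_poly a V E ?x2"
      proof (rule ccontr)
        assume neg: "\<not> ?thesis"
        have "c * hom_poly a V E ?x1 \<le> c * max (hom_poly a V E ?x1) (hom_poly a V E ?x2)"
          "(1 - c) * hom_poly a V E ?x2 \<le> (1 - c) * max (hom_poly a V E ?x1) (hom_poly a V E ?x2)"
          using c by (auto intro!: mult_left_mono)
        with le have "hom_poly a V E x \<le> max (hom_poly a V E ?x1) (hom_poly a V E ?x2)"
          by (simp add: algebra_simps)
        then show False using neg by auto
      qed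
      then show ?thesis using less.hyps[OF 1 W(1)] less.hyps[OF 2 W(2)] by (meson order_trans)
    qed (use less.prems in blast)
  qed
  then show ?thesis using that by blast
qed

text \<open>Two vertices of one part go to non-adjacent vertices, which inside a clique must be
  equal. A contributing map is therefore determined by its values at the representatives
  \<open>(i, 0)\<close>, and these are distinct.\<close>

lemma hom_poly_le_copy_poly:
  assumes "finite V" "is_graph V E" "x \<in> weights V" "\<And>i. i < length a \<Longrightarrow> 1 \<le> a ! i"
    and clique: "\<And>u v. 0 < x u \<Longrightarrow> 0 < x v \<Longrightarrow> u \<noteq> v \<Longrightarrow> {u, v} \<in> E"
  shows "hom_poly a V E x \<le> copy_poly a {i \<in> V. 0 < x i} x"
proof -
  let ?K = "{i \<in> V. 0 < x i}" and ?P = "cmp_verts a"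
  define H' where "H' = {\<phi> \<in> hom_maps a V E. \<forall>w\<in>?P. 0 < x (\<phi> w)}"
  define \<tau> where "\<tau> = (\<lambda>\<phi>::nat \<times> nat \<Rightarrow> 'a. restrict (\<lambda>i. \<phi> (i, 0)) {..<length a})"
  have x0: "0 \<le> x i" for i using assms(3) by (simp add: weights_def)
  have P0: "(i, 0) \<in> ?P" if "i < length a" for i
    using assms(4)[OF that] that by (auto simp: cmp_verts_def)
  have const: "\<phi> (i, t) = \<phi> (i, 0)" if "\<phi> \<in> H'" "(i, t) \<in> ?P" for \<phi> i t
  proof -
    have "i < length a" using that by (simp add: cmp_verts_def)
    then show ?thesis
      using that P0[of i] clique[of "\<phi> (i, t)" "\<phi> (i, 0)"] by (fastforce simp: H'_def hom_maps_def)
  qed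
  have "inj_on \<tau> H'"
  proof (rule inj_onI)
    fix \<phi> \<psi> assume \<phi>: "\<phi> \<in> H'" and \<psi>: "\<psi> \<in> H'" and eq: "\<tau> \<phi> = \<tau> \<psi>"
    show "\<phi> = \<psi>"
    proof (rule PiE_ext)
      show "\<phi> \<in> PiE ?P (\<lambda>_. V)" "\<psi> \<in> PiE ?P (\<lambda>_. V)"
        using \<phi> \<psi> by (auto simp: H'_def hom_maps_def)
      fix w assume w: "w \<in> ?P"
      obtain i t where it: "w = (i, t)" by fastforce
      have "i < length a" using w it by (simp add: cmp_verts_def)
      then have "\<phi> (i, 0) = \<psi> (i, 0)" using fun_cong[OF eq, of i] by (simp add: \<tau>_def)
      then show "\<phi> w = \<psi> w" using const[OF \<phi>] const[OF \<psi>] w it by metis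
    qed
  qed
  have img: "\<tau> ` H' \<subseteq> {\<tau> \<in> {..<length a} \<rightarrow>\<^sub>E ?K. inj_on \<tau> {..<length a}}"
  proof
    fix \<sigma> assume "\<sigma> \<in> \<tau> ` H'"
    then obtain \<phi> where \<phi>: "\<phi> \<in> H'" "\<sigma> = \<tau> \<phi>" by blast
    have "inj_on \<sigma> {..<length a}"
    proof (rule inj_onI)
      fix i j assume ij: "i \<in> {..<length a}" "j \<in> {..<length a}" "\<sigma> i = \<sigma> j"
      then have "{\<phi> (i, 0), \<phi> (j, 0)} \<notin> E"
        using singleton_not_edge[OF assms(2)] by (simp add: \<phi>(2) \<tau>_def)
      then show "i = j"
        using \<phi>(1) P0[of i] P0[of j] ij by (fastforce simp: H'_def hom_maps_def)
    qed
    moreover have "\<sigma> \<in> {..<length a} \<rightarrow>\<^sub>E ?K"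
      using \<phi> P0 by (auto simp: \<tau>_def H'_def hom_maps_def PiE_iff)
    ultimately show "\<sigma> \<in> {\<tau> \<in> {..<length a} \<rightarrow>\<^sub>E ?K. inj_on \<tau> {..<length a}}" by simp
  qed
  have "hom_poly a V E x = (\<Sum>\<phi>\<in>H'. \<Prod>w\<in>?P. x (\<phi> w))"
    unfolding hom_poly_def
  proof (rule sum.mono_neutral_right)
    show "\<forall>\<phi>\<in>hom_maps a V E - H'. (\<Prod>w\<in>?P. x (\<phi> w)) = 0"
    proof
      fix \<phi> assume "\<phi> \<in> hom_maps a V E - H'"
      then obtain w where "w \<in> ?P" "\<not> 0 < x (\<phi> w)" by (auto simp: H'_def)
      then show "(\<Prod>w\<in>?P. x (\<phi> w)) = 0"
        using x0[of "\<phi> w"] by (intro prod_zero) (auto intro!: bexI[of _ w])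
    qed
  qed (use assms(1) in \<open>auto simp: H'_def\<close>)
  also have "\<dots> = (\<Sum>\<phi>\<in>H'. \<Prod>i<length a. x (\<tau> \<phi> i) ^ (a ! i))"
  proof (rule sum.cong)
    fix \<phi> assume \<phi>: "\<phi> \<in> H'"
    have "(\<Prod>w\<in>?P. x (\<phi> w)) = (\<Prod>w\<in>?P. x (\<phi> (fst w, 0)))"
      using const[OF \<phi>] by (intro prod.cong) (auto simp: split_paired_all)
    also have "\<dots> = (\<Prod>i<length a. \<Prod>t<a ! i. x (\<phi> (i, 0)))"
      unfolding cmp_verts_Sigma by (subst prod.Sigma) (auto simp: case_prod_unfold)
    also have "\<dots> = (\<Prod>i<length a. x (\<tau> \<phi> i) ^ (a ! i))"
      by (intro prod.cong) (auto simp: \<tau>_def)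
    finally show "(\<Prod>w\<in>?P. x (\<phi> w)) = (\<Prod>i<length a. x (\<tau> \<phi> i) ^ (a ! i))" .
  qed simp
  also have "\<dots> = (\<Sum>\<sigma>\<in>\<tau> ` H'. \<Prod>i<length a. x (\<sigma> i) ^ (a ! i))"
    using \<open>inj_on \<tau> H'\<close> by (simp add: sum.reindex)
  also have "\<dots> \<le> copy_poly a ?K x"
    unfolding copy_poly_def using img assms(1) x0
    by (intro sum_mono2 prod_nonneg finite_inj_maps) auto
  finally show ?thesis .
qed

lemma card_clique_le:
  assumes "finite V" "\<not> contains_clique (Suc k) V E" "K \<subseteq> V"
    and "\<And>u v. u \<in> K \<Longrightarrow> v \<in> K \<Longrightarrow> u \<noteq> v \<Longrightarrow> {u, v} \<in> E"
  shows "card K \<le> k"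
proof (rule ccontr)
  assume "\<not> ?thesis"
  then obtain S where S: "S \<subseteq> K" "card S = Suc k"
    using obtain_subset_with_card_n[of "Suc k" K] by force
  then have "contains_clique (Suc k) V E"
    unfolding contains_clique_def using assms(3,4) by (intro exI[of _ S]) blast
  then show False using assms(2) by simp
qed

text \<open>Uniform weights \<open>1 / card V\<close> turn the count into a value of
  \<open>hom_poly\<close>. Since non-injective maps are counted too, this is an identity without
  lower-order terms.\<close>

lemma card_hom_maps_le:
  assumes a: "close_parts a" "1 \<le> length a" "\<And>i. i < length a \<Longrightarrow> 1 \<le> a ! i"
    and V: "finite V" "V \<noteq> {}" "is_graph V E" "\<not> contains_clique (Suc k) V E"
    and B: "0 \<le> B" "\<And>j. length a \<le> j \<Longrightarrow> j \<le> k \<Longrightarrow> f_rl (length a) (sum_list a) j \<le> B"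
  shows "real (card (hom_maps a V E)) \<le> B * real (card V) ^ sum_list a"
proof -
  define x where "x = (\<lambda>i. if i \<in> V then 1 / real (card V) else 0)"
  have cV: "real (card V) > 0" using V by (simp add: card_gt_0_iff)
  have "x \<in> weights V" using V by (auto simp: weights_def x_def)
  then obtain y where y: "y \<in> weights V" "hom_poly a V E x \<le> hom_poly a V E y"
    and clique: "\<And>u v. 0 < y u \<Longrightarrow> 0 < y v \<Longrightarrow> u \<noteq> v \<Longrightarrow> {u, v} \<in> E"
    using hom_poly_clique_support[OF V(1,3)] by blast
  let ?K = "{i \<in> V. 0 < y i}"
  have "hom_poly a V E x = (\<Sum>\<phi>\<in>hom_maps a V E. \<Prod>w\<in>cmp_verts a. 1 / real (card V))"
    unfolding hom_poly_def by (intro sum.cong prod.cong) (auto simp: hom_maps_def x_def)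
  also have "\<dots> = real (card (hom_maps a V E)) / real (card V) ^ sum_list a"
    by (simp add: card_cmp_verts power_one_over)
  finally have "real (card (hom_maps a V E)) / real (card V) ^ sum_list a \<le> hom_poly a V E y"
    using y(2) by simp
  also have "\<dots> \<le> copy_poly a ?K y"
    by (rule hom_poly_le_copy_poly[OF V(1,3) y(1) a(3) clique])
  also have "\<dots> \<le> B"
  proof (rule copy_poly_le[OF a])
    have "sum y ?K = sum y V"
      using V y(1) by (intro sum.mono_neutral_left) (auto simp: weights_def not_less intro: antisym)
    then show "y \<in> weights ?K" using y(1) by (auto simp: weights_def intro: antisym simp: not_less)
    have "card ?K \<le> k" using V(1,4) clique by (intro card_clique_le) auto
    then show "f_rl (length a) (sum_list a) j \<le> B" if "length a \<le> j" "j \<le> card ?K" for j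
      using B(2) that by simp
  qed (use V B in auto)
  finally show ?thesis using cV by (simp add: field_simps)
qed

section \<open>Counting embeddings\<close>

text \<open>Such maps split into independent injections between corresponding fibres. Truncated
  subtraction makes a product vanish when the target fibre is too small.\<close>

lemma card_inj_fibre_maps:
  fixes g :: "'a \<Rightarrow> 'c" and h :: "'b \<Rightarrow> 'c"
  assumes "finite A" "finite B"
  shows "card {f \<in> A \<rightarrow>\<^sub>E B. inj_on f A \<and> (\<forall>x\<in>A. h (f x) = g x)}
     = (\<Prod>v\<in>g ` A. \<Prod>i<card {x \<in> A. g x = v}. card {y \<in> B. h y = v} - i)" (is "card ?L = _")
proof -
  let ?A = "\<lambda>v. {x \<in> A. g x = v}" and ?B = "\<lambda>v. {y \<in> B. h y = v}"
  let ?R = "PiE (g ` A) (\<lambda>v. {f \<in> ?A v \<rightarrow>\<^sub>E ?B v. inj_on f (?A v)})"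
  define split where "split = (\<lambda>f::'a \<Rightarrow> 'b. \<lambda>v\<in>g ` A. restrict f (?A v))"
  define join where "join = (\<lambda>F::'c \<Rightarrow> 'a \<Rightarrow> 'b. \<lambda>x\<in>A. F (g x) x)"
  have "bij_betw split ?L ?R"
  proof (rule bij_betw_byWitness[where f' = join])
    show "\<forall>f\<in>?L. join (split f) = f"
      by (auto simp: join_def split_def fun_eq_iff PiE_iff extensional_def)
    show "\<forall>F\<in>?R. split (join F) = F"
    proof
      fix F assume F: "F \<in> ?R"
      have "split (join F) v = F v" for v
      proof (cases "v \<in> g ` A")
        case True
        then have "F v \<in> extensional (?A v)" using F by (auto simp: PiE_iff)
        then show ?thesis using True by (auto simp: join_def split_def fun_eq_iff extensional_def)
      next
        case False
        then show ?thesis using F by (auto simp: split_def PiE_iff extensional_def)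
      qed
      then show "split (join F) = F" by (rule ext)
    qed
    show "split ` ?L \<subseteq> ?R"
      by (auto simp: split_def PiE_iff inj_on_def)
    show "join ` ?R \<subseteq> ?L"
    proof
      fix f assume "f \<in> join ` ?R"
      then obtain F where F: "F \<in> ?R" "f = join F" by blast
      have Fv: "F v \<in> ?A v \<rightarrow>\<^sub>E ?B v" "inj_on (F v) (?A v)" if "v \<in> g ` A" for v
        using F that by (auto simp: PiE_iff)
      have f: "f x \<in> B \<and> h (f x) = g x" if "x \<in> A" for x
        using Fv(1)[of "g x"] that F(2) by (auto simp: join_def PiE_iff)
      have "inj_on f A"
      proof (rule inj_onI)
        fix x y assume xy: "x \<in> A" "y \<in> A" "f x = f y"
        then have "g x = g y" using f by metis
        then show "x = y" using Fv(2)[of "g x"] xy F(2) by (auto simp: join_def inj_on_def)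
      qed
      then show "f \<in> ?L" using f F(2) by (auto simp: join_def)
    qed
  qed
  then have "card ?L = card ?R" by (rule bij_betw_same_card)
  also have "\<dots> = (\<Prod>v\<in>g ` A. \<Prod>i<card (?A v). card (?B v) - i)"
    using assms by (subst card_PiE) (auto simp: card_inj_maps)
  finally show ?thesis .
qed

section \<open>Labelled induced copies and automorphisms\<close>

definition embeddings :: "nat list \<Rightarrow> 'v set \<Rightarrow> 'v set set \<Rightarrow> (nat \<times> nat \<Rightarrow> 'v) set" where
  "embeddings a V E = {\<phi> \<in> hom_maps a V E. inj_on \<phi> (cmp_verts a)}"

lemma mem_cmp_edges:
  "w \<in> cmp_verts a \<Longrightarrow> z \<in> cmp_verts a \<Longrightarrow> {w, z} \<in> cmp_edges a \<longleftrightarrow> fst w \<noteq> fst z"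
  unfolding cmp_edges_def by (auto simp: doubleton_eq_iff simp del: split_paired_Ex)

lemma mem_embeddings:
  "\<phi> \<in> embeddings a V E \<longleftrightarrow> \<phi> \<in> cmp_verts a \<rightarrow>\<^sub>E V \<and> inj_on \<phi> (cmp_verts a) \<and>
     (\<forall>w\<in>cmp_verts a. \<forall>z\<in>cmp_verts a. {\<phi> w, \<phi> z} \<in> E \<longleftrightarrow> fst w \<noteq> fst z)"
  by (auto simp: embeddings_def hom_maps_def)

lemma finite_embeddings [simp]: "finite V \<Longrightarrow> finite (embeddings a V E)"
  by (simp add: embeddings_def)

text \<open>Composing with a fixed isomorphism from \<open>S\<close> to the pattern turns the
  embeddings onto \<open>S\<close> into automorphisms, and its inverse leads back.\<close>

lemma card_embeddings_image:
  assumes "S \<subseteq> V" "induced_iso S E (cmp_verts a) (cmp_edges a)"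
  shows "card {\<phi> \<in> embeddings a V E. \<phi> ` cmp_verts a = S}
       = card (embeddings a (cmp_verts a) (cmp_edges a))"
proof -
  let ?P = "cmp_verts a"
  obtain f where f: "bij_betw f S ?P"
    and fE: "\<And>x y. x \<in> S \<Longrightarrow> y \<in> S \<Longrightarrow> {x, y} \<in> E \<longleftrightarrow> {f x, f y} \<in> cmp_edges a"
    using assms(2) by (auto simp: induced_iso_def)
  have fP: "f x \<in> ?P" if "x \<in> S" for x using f that by (auto simp: bij_betw_def)
  define g where "g = inv_into S f"
  have g: "bij_betw g ?P S" unfolding g_def by (rule bij_betw_inv_into[OF f])
  have gS: "g x \<in> S" if "x \<in> ?P" for x using g that by (auto simp: bij_betw_def)
  have fg: "f (g x) = x" if "x \<in> ?P" for x
    unfolding g_def using bij_betw_inv_into_right[OF f that] .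
  have gf: "g (f x) = x" if "x \<in> S" for x
    unfolding g_def using bij_betw_inv_into_left[OF f that] .
  have "bij_betw (\<lambda>\<phi>. restrict (f \<circ> \<phi>) ?P) {\<phi> \<in> embeddings a V E. \<phi> ` ?P = S}
      (embeddings a ?P (cmp_edges a))"
  proof (rule bij_betw_byWitness[where f' = "\<lambda>\<alpha>. restrict (g \<circ> \<alpha>) ?P"])
    show "\<forall>\<phi>\<in>{\<phi> \<in> embeddings a V E. \<phi> ` ?P = S}. restrict (g \<circ> restrict (f \<circ> \<phi>) ?P) ?P = \<phi>"
      using gf by (auto simp: mem_embeddings PiE_iff extensional_def fun_eq_iff)
    show "\<forall>\<alpha>\<in>embeddings a ?P (cmp_edges a). restrict (f \<circ> restrict (g \<circ> \<alpha>) ?P) ?P = \<alpha>"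
      using fg by (auto simp: mem_embeddings PiE_iff extensional_def fun_eq_iff)
    show "(\<lambda>\<phi>. restrict (f \<circ> \<phi>) ?P) ` {\<phi> \<in> embeddings a V E. \<phi> ` ?P = S}
        \<subseteq> embeddings a ?P (cmp_edges a)"
    proof
      fix \<alpha> assume "\<alpha> \<in> (\<lambda>\<phi>. restrict (f \<circ> \<phi>) ?P) ` {\<phi> \<in> embeddings a V E. \<phi> ` ?P = S}"
      then obtain \<phi> where \<phi>: "\<phi> \<in> embeddings a V E" "\<phi> ` ?P = S" "\<alpha> = restrict (f \<circ> \<phi>) ?P"
        by blast
      have \<phi>S: "\<phi> w \<in> S" if "w \<in> ?P" for w using \<phi>(2) that by blast
      have "inj_on (f \<circ> \<phi>) ?P"
        using \<phi> f by (intro comp_inj_on) (auto simp: mem_embeddings bij_betw_def)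
      then have "inj_on \<alpha> ?P" by (simp add: \<phi>(3) inj_on_restrict_eq)
      then show "\<alpha> \<in> embeddings a ?P (cmp_edges a)"
        using \<phi>(1) \<phi>S fP fE by (auto simp: mem_embeddings \<phi>(3))
    qed
    show "(\<lambda>\<alpha>. restrict (g \<circ> \<alpha>) ?P) ` embeddings a ?P (cmp_edges a)
        \<subseteq> {\<phi> \<in> embeddings a V E. \<phi> ` ?P = S}"
    proof
      fix \<phi> assume "\<phi> \<in> (\<lambda>\<alpha>. restrict (g \<circ> \<alpha>) ?P) ` embeddings a ?P (cmp_edges a)"
      then obtain \<alpha> where \<alpha>: "\<alpha> \<in> embeddings a ?P (cmp_edges a)" "\<phi> = restrict (g \<circ> \<alpha>) ?P"
        by blast
      have \<alpha>P: "\<alpha> w \<in> ?P" if "w \<in> ?P" for w using \<alpha>(1) that by (auto simp: mem_embeddings)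
      have inj: "inj_on \<alpha> ?P" using \<alpha>(1) by (simp add: mem_embeddings)
      have \<alpha>P': "\<alpha> ` ?P = ?P" using \<alpha>P inj by (intro endo_inj_surj) auto
      moreover have "\<phi> ` ?P = g ` (\<alpha> ` ?P)" by (simp add: \<alpha>(2) image_image)
      ultimately have im: "\<phi> ` ?P = S" using g by (simp add: bij_betw_def)
      have "inj_on (g \<circ> \<alpha>) ?P"
        using inj g \<alpha>P' by (intro comp_inj_on) (auto simp: bij_betw_def)
      then have "inj_on \<phi> ?P" by (simp add: \<alpha>(2) inj_on_restrict_eq)
      moreover have "g w \<in> V" if "w \<in> ?P" for w using gS[OF that] assms(1) by blast
      ultimately have "\<phi> \<in> embeddings a V E"
        using \<alpha>(1) \<alpha>P gS fg fE by (auto simp: mem_embeddings \<alpha>(2))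
      with im show "\<phi> \<in> {\<phi> \<in> embeddings a V E. \<phi> ` ?P = S}" by simp
    qed
  qed
  then show ?thesis by (rule bij_betw_same_card)
qed

text \<open>Double counting by image: each induced copy is hit once per automorphism of the
  pattern.\<close>

lemma card_embeddings:
  assumes "finite V"
  shows "card (embeddings a V E) = induced_count (cmp_verts a) (cmp_edges a) V E
       * card (embeddings a (cmp_verts a) (cmp_edges a))"
proof -
  let ?P = "cmp_verts a"
  define I where "I = {S. S \<subseteq> V \<and> card S = card ?P \<and> induced_iso S E ?P (cmp_edges a)}"
  have im: "(\<lambda>\<phi>. \<phi> ` ?P) ` embeddings a V E \<subseteq> I"
  proof
    fix S assume "S \<in> (\<lambda>\<phi>. \<phi> ` ?P) ` embeddings a V E"
    then obtain \<phi> where \<phi>: "\<phi> \<in> embeddings a V E" "S = \<phi> ` ?P" by blast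
    have inj: "inj_on \<phi> ?P" using \<phi>(1) by (simp add: mem_embeddings)
    have "bij_betw (inv_into ?P \<phi>) S ?P"
      using inj \<phi>(2) by (intro bij_betw_inv_into) (simp add: bij_betw_def)
    moreover have "{x, y} \<in> E \<longleftrightarrow> {inv_into ?P \<phi> x, inv_into ?P \<phi> y} \<in> cmp_edges a"
      if "x \<in> S" "y \<in> S" for x y
      using that \<phi> inj by (auto simp: mem_cmp_edges mem_embeddings)
    ultimately have "induced_iso S E ?P (cmp_edges a)" unfolding induced_iso_def by blast
    moreover have "S \<subseteq> V" using \<phi> by (auto simp: mem_embeddings)
    ultimately show "S \<in> I" using \<phi>(2) inj by (simp add: I_def card_image)
  qed
  have "finite I" using assms by (auto simp: I_def)
  have "card (embeddings a V E) = (\<Sum>\<phi>\<in>embeddings a V E. 1)" by simp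
  also have "\<dots> = (\<Sum>S\<in>I. \<Sum>\<phi>\<in>{\<phi> \<in> embeddings a V E. \<phi> ` ?P = S}. 1)"
    using assms im \<open>finite I\<close> by (intro sum.group[symmetric]) auto
  also have "\<dots> = (\<Sum>S\<in>I. card (embeddings a ?P (cmp_edges a)))"
    by (intro sum.cong) (auto simp: I_def card_embeddings_image)
  finally show ?thesis by (simp add: I_def induced_count_def)
qed

text \<open>Equal colour under \<open>h\<close> means non-adjacent, so an embedding puts each part
  of the pattern into one colour class and distinct parts into distinct classes;
  \<open>\<tau>\<close> records this. It is applied to Turan graphs and to the pattern
  itself.\<close>

lemma card_embeddings_multipartite:
  assumes "finite V" "finite C" "h ` V \<subseteq> C" "\<And>i. i < length a \<Longrightarrow> 1 \<le> a ! i"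
    and E: "\<And>x y. x \<in> V \<Longrightarrow> y \<in> V \<Longrightarrow> {x, y} \<in> E \<longleftrightarrow> h x \<noteq> h y"
  shows "card (embeddings a V E)
     = (\<Sum>\<tau>\<in>{\<tau> \<in> {..<length a} \<rightarrow>\<^sub>E C. inj_on \<tau> {..<length a}}.
          \<Prod>i<length a. \<Prod>t<a ! i. card {v \<in> V. h v = \<tau> i} - t)"
proof -
  let ?P = "cmp_verts a" and ?T = "{\<tau> \<in> {..<length a} \<rightarrow>\<^sub>E C. inj_on \<tau> {..<length a}}"
  define col where "col = (\<lambda>\<phi>::nat \<times> nat \<Rightarrow> _. \<lambda>i\<in>{..<length a}. h (\<phi> (i, 0)))"
  have P0: "(i, 0) \<in> ?P" if "i < length a" for i
    using assms(4)[OF that] that by (auto simp: cmp_verts_def)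
  have Pfst: "fst w < length a" if "w \<in> ?P" for w using that by (auto simp: cmp_verts_def)
  have emb: "{\<phi> w, \<phi> z} \<in> E \<longleftrightarrow> h (\<phi> w) \<noteq> h (\<phi> z)"
    if "\<phi> \<in> ?P \<rightarrow>\<^sub>E V" "w \<in> ?P" "z \<in> ?P" for \<phi> w z
    using that by (intro E) auto
  have h_eq: "h (\<phi> w) = h (\<phi> z) \<longleftrightarrow> fst w = fst z"
    if "\<phi> \<in> embeddings a V E" "w \<in> ?P" "z \<in> ?P" for \<phi> w z
    using that emb[of \<phi> w z] unfolding mem_embeddings by blast
  have colT: "col \<phi> \<in> ?T" if \<phi>: "\<phi> \<in> embeddings a V E" for \<phi>
  proof -
    have "\<phi> (i, 0) \<in> V" if "i < length a" for i
      using \<phi> P0[OF that] by (auto simp: mem_embeddings)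
    moreover have "inj_on (col \<phi>) {..<length a}"
      using h_eq[OF \<phi> P0 P0] by (auto simp: inj_on_def col_def)
    ultimately show ?thesis using assms(3) by (auto simp: col_def)
  qed
  have fib: "{\<phi> \<in> embeddings a V E. col \<phi> = \<tau>}
      = {\<phi> \<in> ?P \<rightarrow>\<^sub>E V. inj_on \<phi> ?P \<and> (\<forall>w\<in>?P. h (\<phi> w) = \<tau> (fst w))}" if \<tau>: "\<tau> \<in> ?T" for \<tau>
  proof (intro set_eqI iffI)
    fix \<phi> assume "\<phi> \<in> {\<phi> \<in> embeddings a V E. col \<phi> = \<tau>}"
    then have \<phi>: "\<phi> \<in> embeddings a V E" "\<tau> = col \<phi>" by auto
    have "h (\<phi> w) = \<tau> (fst w)" if "w \<in> ?P" for w
      using h_eq[OF \<phi>(1) that P0[OF Pfst[OF that]]] Pfst[OF that] by (simp add: \<phi>(2) col_def)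
    then show "\<phi> \<in> {\<phi> \<in> ?P \<rightarrow>\<^sub>E V. inj_on \<phi> ?P \<and> (\<forall>w\<in>?P. h (\<phi> w) = \<tau> (fst w))}"
      using \<phi>(1) by (auto simp: mem_embeddings)
  next
    fix \<phi> assume \<phi>: "\<phi> \<in> {\<phi> \<in> ?P \<rightarrow>\<^sub>E V. inj_on \<phi> ?P \<and> (\<forall>w\<in>?P. h (\<phi> w) = \<tau> (fst w))}"
    have "\<tau> (fst w) = \<tau> (fst z) \<longleftrightarrow> fst w = fst z" if "w \<in> ?P" "z \<in> ?P" for w z
      using \<tau> Pfst[OF that(1)] Pfst[OF that(2)] by (auto simp: inj_on_def)
    then have "\<phi> \<in> embeddings a V E" using \<phi> emb[of \<phi>] by (auto simp: mem_embeddings)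
    moreover have "col \<phi> = \<tau>"
      using \<phi> \<tau> P0 by (auto simp: col_def fun_eq_iff PiE_iff extensional_def)
    ultimately show "\<phi> \<in> {\<phi> \<in> embeddings a V E. col \<phi> = \<tau>}" by simp
  qed
  have num: "card {\<phi> \<in> embeddings a V E. col \<phi> = \<tau>}
      = (\<Prod>i<length a. \<Prod>t<a ! i. card {v \<in> V. h v = \<tau> i} - t)" if \<tau>: "\<tau> \<in> ?T" for \<tau>
  proof -
    have inj: "inj_on \<tau> {..<length a}" using \<tau> by simp
    have "card {w \<in> ?P. \<tau> (fst w) = \<tau> i} = a ! i" if "i < length a" for i
    proof -
      have "{w \<in> ?P. \<tau> (fst w) = \<tau> i} = {i} \<times> {..<a ! i}"
        using inj that by (fastforce simp: cmp_verts_def dest: inj_onD)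
      then show ?thesis by (simp add: card_cartesian_product)
    qed
    moreover have "(\<lambda>w. \<tau> (fst w)) ` ?P = \<tau> ` {..<length a}"
      using P0 Pfst by force
    ultimately show ?thesis
      unfolding fib[OF \<tau>] using assms(1) inj
      by (subst card_inj_fibre_maps) (auto simp: prod.reindex)
  qed
  have "card (embeddings a V E) = (\<Sum>\<phi>\<in>embeddings a V E. 1)" by simp
  also have "\<dots> = (\<Sum>\<tau>\<in>?T. \<Sum>\<phi>\<in>{\<phi> \<in> embeddings a V E. col \<phi> = \<tau>}. 1)"
    using assms(1,2) colT by (intro sum.group[symmetric]) auto
  also have "\<dots> = (\<Sum>\<tau>\<in>?T. \<Prod>i<length a. \<Prod>t<a ! i. card {v \<in> V. h v = \<tau> i} - t)"
    by (intro sum.cong) (auto simp: num)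
  finally show ?thesis .
qed

lemma prod_diff_eq_fact: "(\<Prod>t<n. n - t) = (fact n :: nat)"
  by (simp add: fact_prod_rev lessThan_atLeast0)

text \<open>The pattern is its own host, coloured by \<open>fst\<close>. Then \<open>\<tau>\<close>
  permutes the parts; size-preserving permutations give \<open>sym_parts\<close>, and each carries
  the product of the factorials.\<close>

lemma card_automorphisms:
  assumes "\<And>i. i < length a \<Longrightarrow> 1 \<le> a ! i"
  shows "card (embeddings a (cmp_verts a) (cmp_edges a)) = prod_list (map fact a) * sym_parts a"
proof -
  let ?r = "length a" and ?T = "{\<tau> \<in> {..<length a} \<rightarrow>\<^sub>E {..<length a}. inj_on \<tau> {..<length a}}"
  let ?T' = "{\<tau> \<in> {..<length a} \<rightarrow>\<^sub>E {..<length a}. inj_on \<tau> {..<length a} \<and> (\<forall>i\<in>{..<length a}. a ! \<tau> i = a ! i)}"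
  have part: "card {v \<in> cmp_verts a. fst v = j} = a ! j" if "j < ?r" for j
  proof -
    have "{v \<in> cmp_verts a. fst v = j} = {j} \<times> {..<a ! j}"
      using that by (auto simp: cmp_verts_def)
    then show ?thesis by (simp add: card_cartesian_product)
  qed
  have "card (embeddings a (cmp_verts a) (cmp_edges a))
      = (\<Sum>\<tau>\<in>?T. \<Prod>i<?r. \<Prod>t<a ! i. card {v \<in> cmp_verts a. fst v = \<tau> i} - t)"
    using assms by (intro card_embeddings_multipartite) (auto simp: mem_cmp_edges, auto simp: cmp_verts_def)
  also have "\<dots> = (\<Sum>\<tau>\<in>?T. \<Prod>i<?r. \<Prod>t<a ! i. a ! \<tau> i - t)"
    by (intro sum.cong prod.cong) (auto simp: part PiE_iff)
  also have "\<dots> = (\<Sum>\<tau>\<in>?T'. \<Prod>i<?r. \<Prod>t<a ! i. a ! \<tau> i - t)"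
  proof (rule sum.mono_neutral_right)
    show "\<forall>\<tau>\<in>?T - ?T'. (\<Prod>i<?r. \<Prod>t<a ! i. a ! \<tau> i - t) = 0"
    proof
      fix \<tau> assume \<tau>: "\<tau> \<in> ?T - ?T'"
      \<comment> \<open>Otherwise no part moves to a smaller one, and since a permutation keeps the
        total size, all sizes would agree.\<close>
      have "\<exists>i<?r. a ! \<tau> i < a ! i"
      proof (rule ccontr)
        assume "\<not> ?thesis"
        then have ge: "a ! i \<le> a ! \<tau> i" if "i < ?r" for i using that by (meson not_le)
        have "\<tau> ` {..<?r} = {..<?r}" using \<tau> by (intro endo_inj_surj) (auto simp: PiE_iff)
        then have "(\<Sum>i<?r. a ! \<tau> i) = (\<Sum>i<?r. a ! i)"
          using \<tau> by (intro sum.reindex_bij_betw) (auto simp: bij_betw_def)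
        moreover obtain i where "i < ?r" "a ! \<tau> i \<noteq> a ! i" using \<tau> by auto
        then have "(\<Sum>i<?r. a ! i) < (\<Sum>i<?r. a ! \<tau> i)"
          using ge by (intro sum_strict_mono_ex1) (auto intro!: bexI[of _ i] simp: le_neq_implies_less)
        ultimately show False by simp
      qed
      then obtain i where "i < ?r" "a ! \<tau> i < a ! i" by blast
      then have "(\<Prod>t<a ! i. a ! \<tau> i - t) = 0" by (auto intro!: bexI[of _ "a ! \<tau> i"])
      then show "(\<Prod>i<?r. \<Prod>t<a ! i. a ! \<tau> i - t) = 0"
        using \<open>i < ?r\<close> by (intro prod_zero) (auto intro: bexI[of _ i])
    qed
  qed auto
  also have "\<dots> = (\<Sum>\<tau>\<in>?T'. \<Prod>i<?r. fact (a ! i))"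
    by (intro sum.cong prod.cong) (auto simp: prod_diff_eq_fact)
  also have "\<dots> = card ?T' * prod_list (map fact a)"
    by (simp add: prod.list_conv_set_nth atLeast0LessThan)
  also have "card ?T' = (\<Prod>v\<in>(!) a ` {..<?r}. \<Prod>i<card {x \<in> {..<?r}. a ! x = v}. card {x \<in> {..<?r}. a ! x = v} - i)"
    by (rule card_inj_fibre_maps) auto
  also have "\<dots> = (\<Prod>v\<in>set a. fact (count_list a v))"
  proof (rule prod.cong)
    show "(!) a ` {..<?r} = set a" by (auto simp: set_conv_nth)
    fix v
    have "card {x \<in> {..<?r}. a ! x = v} = count_list a v"
      by (simp add: count_list_eq_length_filter length_filter_conv_card eq_commute)
    then show "(\<Prod>i<card {x \<in> {..<?r}. a ! x = v}. card {x \<in> {..<?r}. a ! x = v} - i) = fact (count_list a v)"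
      by (simp add: prod_diff_eq_fact)
  qed
  finally show ?thesis by (simp add: sym_parts_def mult.commute)
qed

section \<open>Turan graphs and the lower bound\<close>

definition turan_edges :: "nat \<Rightarrow> nat \<Rightarrow> nat set set" where
  "turan_edges j n = {{x, y} | x y. x < n \<and> y < n \<and> x mod j \<noteq> y mod j}"

lemma mem_turan_edges:
  "x < n \<Longrightarrow> y < n \<Longrightarrow> {x, y} \<in> turan_edges j n \<longleftrightarrow> x mod j \<noteq> y mod j"
  by (auto simp: turan_edges_def doubleton_eq_iff)

lemma is_graph_turan: "is_graph {..<n} (turan_edges j n)"
  by (auto simp: is_graph_def turan_edges_def card_2_iff)

lemma turan_clique_free:
  assumes "0 < j" "j \<le> k"
  shows "\<not> contains_clique (k + 1) {..<n} (turan_edges j n)"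
proof
  assume "contains_clique (k + 1) {..<n} (turan_edges j n)"
  then obtain S where S: "S \<subseteq> {..<n}" "card S = k + 1"
    "\<And>x y. x \<in> S \<Longrightarrow> y \<in> S \<Longrightarrow> x \<noteq> y \<Longrightarrow> {x, y} \<in> turan_edges j n"
    unfolding contains_clique_def by blast
  have "inj_on (\<lambda>x. x mod j) S"
  proof (rule inj_onI, rule ccontr)
    fix x y assume "x \<in> S" "y \<in> S" "x mod j = y mod j" "x \<noteq> y"
    then show False using S(3)[of x y] S(1) mem_turan_edges[of x n y j] by auto
  qed
  then have "card S \<le> card {..<j}" using assms by (intro card_inj_on_le[of "\<lambda>x. x mod j"]) auto
  then show False using S(2) assms by simp
qed

lemma card_residue_class_ge:
  assumes "c < j"
  shows "n div j \<le> card {v \<in> {..<n}. v mod j = c}"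
proof -
  have "(\<lambda>q. q * j + c) ` {..<n div j} \<subseteq> {v \<in> {..<n}. v mod j = c}"
  proof
    fix v assume "v \<in> (\<lambda>q. q * j + c) ` {..<n div j}"
    then obtain q where q: "Suc q \<le> n div j" "v = q * j + c"
      by (auto simp: Suc_le_eq)
    have "Suc q * j \<le> n"
      using mult_right_mono[OF q(1), of j] div_times_less_eq_dividend[of n j] by linarith
    then show "v \<in> {v \<in> {..<n}. v mod j = c}" using q(2) assms by auto
  qed
  then have "card ((\<lambda>q. q * j + c) ` {..<n div j}) \<le> card {v \<in> {..<n}. v mod j = c}"
    by (intro card_mono) auto
  moreover have "inj_on (\<lambda>q. q * j + c) {..<n div j}" using assms by (auto simp: inj_on_def)
  ultimately show ?thesis by (simp add: card_image)
qed

text \<open>Every class has at least \<open>n div j\<close> vertices, and each of the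
  \<open>sum_list a\<close> factors loses less than \<open>sum_list a\<close>. This crude loss is of
  lower order in \<open>n\<close>.\<close>

lemma card_embeddings_turan_ge:
  assumes "0 < j" "\<And>i. i < length a \<Longrightarrow> 1 \<le> a ! i"
  shows "(\<Prod>i<length a. j - i) * (n div j - sum_list a) ^ sum_list a
     \<le> card (embeddings a {..<n} (turan_edges j n))"
proof -
  let ?r = "length a" and ?q = "n div j" and ?l = "sum_list a"
  let ?T = "{\<tau> \<in> {..<length a} \<rightarrow>\<^sub>E {..<j}. inj_on \<tau> {..<length a}}"
  have "(\<Prod>i<?r. j - i) * (?q - ?l) ^ ?l = (\<Sum>\<tau>\<in>?T. (?q - ?l) ^ ?l)"
    by (simp add: card_inj_maps)
  also have "\<dots> \<le> (\<Sum>\<tau>\<in>?T. \<Prod>i<?r. \<Prod>t<a ! i. card {v \<in> {..<n}. v mod j = \<tau> i} - t)"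
  proof (rule sum_mono)
    fix \<tau> assume \<tau>: "\<tau> \<in> ?T"
    have "(?q - ?l) ^ ?l = (\<Prod>i<?r. \<Prod>t<a ! i. ?q - ?l)"
      by (simp add: sum_list_sum_nth atLeast0LessThan power_sum)
    also have "\<dots> \<le> (\<Prod>i<?r. \<Prod>t<a ! i. card {v \<in> {..<n}. v mod j = \<tau> i} - t)"
    proof (intro prod_mono conjI)
      fix i t assume it: "i \<in> {..<?r}" "t \<in> {..<a ! i}"
      have "a ! i \<le> ?l" using it by (intro member_le_sum_list) auto
      moreover have "?q \<le> card {v \<in> {..<n}. v mod j = \<tau> i}"
        using \<tau> it by (intro card_residue_class_ge) auto
      ultimately show "?q - ?l \<le> card {v \<in> {..<n}. v mod j = \<tau> i} - t"
        using it by auto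
    qed auto
    finally show "(?q - ?l) ^ ?l \<le> (\<Prod>i<?r. \<Prod>t<a ! i. card {v \<in> {..<n}. v mod j = \<tau> i} - t)" .
  qed
  also have "\<dots> = card (embeddings a {..<n} (turan_edges j n))"
    using assms by (intro card_embeddings_multipartite[symmetric]) (auto simp: mem_turan_edges)
  finally show ?thesis .
qed

section \<open>The limit\<close>

lemma finite_I_max_set:
  fixes n :: nat
  shows "finite {induced_count VF EF {..<n} E | E. is_graph {..<n} E \<and> \<not> contains_clique s {..<n} E}"
proof (rule finite_subset)
  show "{induced_count VF EF {..<n} E | E. is_graph {..<n} E \<and> \<not> contains_clique s {..<n} E}
      \<subseteq> induced_count VF EF {..<n} ` Pow (Pow {..<n})"
    by (auto simp: is_graph_def intro!: imageI)
qed simp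

lemma I_max_ge:
  assumes "is_graph {..<n} E" "\<not> contains_clique s {..<n} E"
  shows "induced_count VF EF {..<n} E \<le> I_max s VF EF n"
  unfolding I_max_def using assms by (intro Max_ge finite_I_max_set) blast

text \<open>The edgeless graph shows that the maximum is over a nonempty set, since a clique on
  \<open>s >= 2\<close> vertices has an edge.\<close>

lemma I_max_attained:
  assumes "2 \<le> s"
  obtains E where "is_graph {..<n} E" "\<not> contains_clique s {..<n} E"
    "I_max s VF EF n = induced_count VF EF {..<n} E"
proof -
  have "\<not> contains_clique s {..<n} {}"
  proof
    assume "contains_clique s {..<n} {}"
    then obtain S :: "nat set" where S: "card S = s" "\<forall>x\<in>S. \<forall>y\<in>S. x \<noteq> y \<longrightarrow> {x, y} \<in> {}"
      unfolding contains_clique_def by blast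
    then have "finite S" using assms by (intro card_ge_0_finite) simp
    moreover have "\<forall>x\<in>S. \<forall>y\<in>S. x = y" using S(2) by blast
    ultimately have "card S \<le> Suc 0" by (rule iffD2[OF card_le_Suc0_iff_eq])
    then show False using S(1) assms by simp
  qed
  then have "{induced_count VF EF {..<n} E | E. is_graph {..<n} E \<and> \<not> contains_clique s {..<n} E} \<noteq> {}"
    by (auto simp: is_graph_def intro!: exI[of _ "{}"])
  from Max_in[OF finite_I_max_set this] that show ?thesis unfolding I_max_def by blast
qed

text \<open>The extreme pair is the worst case: it has the largest gap, and no part is smaller than
  \<open>last a\<close>.\<close>

lemma almost_balanced_close_parts:
  assumes "sorted_wrt (\<ge>) a" "almost_balanced a"
  shows "close_parts a"
  unfolding close_parts_def
proof (intro allI impI)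
  fix i j assume ij: "i < length a" "j < length a"
  have b: "last a \<le> a ! i \<and> a ! i \<le> hd a" if "i < length a" for i
  proof -
    have mono: "a ! q \<le> a ! p" if "p \<le> q" "q < length a" for p q
      using sorted_wrt_nth_less[OF assms(1), of p q] that by (cases "p = q") auto
    have "a ! (length a - 1) \<le> a ! i" "a ! i \<le> a ! 0"
      using that by (auto intro!: mono)
    then show ?thesis using that by (cases a) (auto simp: last_conv_nth)
  qed
  have "(max (a ! i) (a ! j) - min (a ! i) (a ! j)) choose 2 \<le> (hd a - last a) choose 2"
    using b[OF ij(1)] b[OF ij(2)] by (intro binomial_right_mono) linarith
  also have "\<dots> < last a" using assms(2) by (simp add: almost_balanced_def)
  also have "\<dots> \<le> min (a ! i) (a ! j)" using b ij by simp
  finally show "(max (a ! i) (a ! j) - min (a ! i) (a ! j)) choose 2 < min (a ! i) (a ! j)" .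
qed

lemma falling_eq_f_rl:
  assumes "1 \<le> r" "r \<le> k"
  shows "falling (int k - 1) (r - 1) / real k ^ (l - 1) = f_rl r l k"
proof -
  have "(\<Prod>i<r - 1. real_of_int (int k - 1 - int i)) = (\<Prod>i\<in>{1..<r}. real k - real i)"
    by (intro prod.reindex_bij_witness[of _ "\<lambda>i. i - 1" Suc]) auto
  then show ?thesis using assms by (simp add: falling_def f_rl_def)
qed

lemma power_over_choose_tendsto:
  "(\<lambda>n. real n ^ l / real (n choose l)) \<longlonglongrightarrow> fact l"
proof -
  have "(\<lambda>n. fact l * (\<Prod>i<l. real n / (real n - real i))) \<longlonglongrightarrow> fact l * (\<Prod>i<l. 1)"
  proof (intro tendsto_intros)
    fix i
    show "(\<lambda>n. real n / (real n - real i)) \<longlonglongrightarrow> 1" by real_asymp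
  qed
  moreover have "eventually (\<lambda>n. fact l * (\<Prod>i<l. real n / (real n - real i))
      = real n ^ l / real (n choose l)) sequentially"
    using eventually_ge_at_top[of l]
  proof eventually_elim
    case (elim n)
    have "real (n choose l) = (\<Prod>i<l. real n - real i) / fact l"
      by (simp add: binomial_gbinomial gbinomial_prod_rev atLeast0LessThan)
    then show ?case by (simp add: prod_dividef)
  qed
  ultimately show ?thesis by (simp add: tendsto_cong)
qed

lemma div_power_ratio_tendsto:
  assumes "0 < j"
  shows "(\<lambda>n. real (n div j - l) ^ l / real n ^ l) \<longlonglongrightarrow> (1 / real j) ^ l"
proof -
  have j: "real j > 0" using assms by simp
  have div: "real n / real j - 1 \<le> real (n div j) \<and> real (n div j) \<le> real n / real j" for n
  proof -
    have "real n = real (n div j) * real j + real (n mod j)"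
      by (metis div_mult_mod_eq of_nat_add of_nat_mult)
    moreover have "real (n mod j) < real j" using assms by simp
    ultimately show ?thesis using j by (auto simp: field_simps)
  qed
  have "(\<lambda>n. real (n div j - l) / real n) \<longlonglongrightarrow> 1 / real j"
  proof (rule tendsto_sandwich)
    show "(\<lambda>n. (real n / real j - 1 - real l) / real n) \<longlonglongrightarrow> 1 / real j"
      using j by real_asymp (simp add: inverse_eq_divide)
    show "eventually (\<lambda>n. (real n / real j - 1 - real l) / real n \<le> real (n div j - l) / real n) sequentially"
    proof (intro always_eventually allI divide_right_mono)
      fix n
      show "real n / real j - 1 - real l \<le> real (n div j - l)" using div[of n] by linarith
    qed simp
    show "eventually (\<lambda>n. real (n div j - l) / real n \<le> 1 / real j) sequentially"
      using eventually_gt_at_top[of 0]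
    proof eventually_elim
      case (elim n)
      have "real (n div j - l) \<le> real n / real j"
        using div[of n] by linarith
      then show ?case using elim j by (simp add: field_simps)
    qed
  qed simp
  from tendsto_power[OF this, of l] show ?thesis by (simp add: power_divide)
qed

theorem theorem1p3:
  fixes a :: "nat list" and r l k :: nat
  assumes "length a = r" and "r \<ge> 2" and "l = sum_list a" and "l \<ge> r + 1"
    and "sorted_wrt (\<ge>) a" and "\<forall>x\<in>set a. x \<ge> 1"
    and "almost_balanced a"
    and "k \<ge> r"
  shows "(\<lambda>n. real (I_max (k + 1) (cmp_verts a) (cmp_edges a) n) / real (n choose l))
           \<longlonglongrightarrow>
         (let m = m_rl r l in
            if k \<le> m - 1 then kappa a * falling (int k - 1) (r - 1) / real k ^ (l - 1)
            else kappa a * falling (int m - 1) (r - 1) / real m ^ (l - 1))"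
proof -
  \<comment> \<open>The two cases of the claim merge in \<open>min k m\<close>, which is
    \<open>k\<close> if \<open>k <= m - 1\<close> and \<open>m\<close> otherwise.\<close>
  define j where "j = min k (m_rl r l)"
  define F where "F = f_rl r l j"
  define A where "A = card (embeddings a (cmp_verts a) (cmp_edges a))"
  define I where "I = (\<lambda>n. I_max (k + 1) (cmp_verts a) (cmp_edges a) n)"
  have rl: "2 \<le> r" "r < l" "1 \<le> r" "r \<le> l" using assms by auto
  have m: "r \<le> m_rl r l" by (rule m_rl_maximal(1)[OF rl(1,2)])
  have j: "r \<le> j" "j \<le> k" "0 < j" using m assms rl by (auto simp: j_def)
  have a1: "1 \<le> a ! i" if "i < length a" for i using assms(6) that by simp
  have aut: "A = prod_list (map fact a) * sym_parts a"
    unfolding A_def by (rule card_automorphisms[OF a1])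
  have "0 < sym_parts a" by (simp add: sym_parts_def)
  moreover have "0 < prod_list (map fact a :: nat list)" by (induction a) auto
  ultimately have A: "0 < A" by (simp add: aut)
  have kappa: "kappa a = fact l / real A"
    by (simp add: kappa_def aut assms(3))
  have lim: "(let m = m_rl r l in
            if k \<le> m - 1 then kappa a * falling (int k - 1) (r - 1) / real k ^ (l - 1)
            else kappa a * falling (int m - 1) (r - 1) / real m ^ (l - 1)) = F * (fact l / A)"
  proof -
    have e: "kappa a * falling (int i - 1) (r - 1) / real i ^ (l - 1) = f_rl r l i * (fact l / A)"
      if "r \<le> i" for i
      using falling_eq_f_rl[OF rl(3) that, of l] by (metis kappa mult.commute times_divide_eq_right)
    show ?thesis
    proof (cases "k \<le> m_rl r l - 1")
      case True
      then have "j = k" by (simp add: j_def)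
      then show ?thesis by (simp only: Let_def True if_True e[OF assms(8)] F_def)
    next
      case False
      then have "j = m_rl r l" by (simp add: j_def)
      then show ?thesis by (simp only: Let_def False if_False e[OF m] F_def)
    qed
  qed
  have F0: "0 \<le> F" unfolding F_def using f_rl_pos[of r j l] rl j by simp
  have upper: "real (I n) * A \<le> F * real n ^ l" if "0 < n" for n
  proof -
    obtain E where E: "is_graph {..<n} E" "\<not> contains_clique (k + 1) {..<n} E"
      "I n = induced_count (cmp_verts a) (cmp_edges a) {..<n} E"
      unfolding I_def
    proof (rule I_max_attained)
      show "2 \<le> k + 1" using rl assms(8) by linarith
    qed
    have "real (I n) * A = real (card (embeddings a {..<n} E))"
      using card_embeddings[of "{..<n}" a E] E(3) by (simp add: A_def)
    also have "\<dots> \<le> real (card (hom_maps a {..<n} E))"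
      by (auto intro!: card_mono simp: embeddings_def)
    also have "\<dots> \<le> F * real (card {..<n}) ^ sum_list a"
    proof (rule card_hom_maps_le)
      show "close_parts a" by (rule almost_balanced_close_parts[OF assms(5,7)])
      show "f_rl (length a) (sum_list a) i \<le> F" if "length a \<le> i" "i \<le> k" for i
        unfolding F_def j_def using that assms(1,3) f_rl_le_min[OF rl(1,2)] by simp
    qed (use that E a1 assms(1) rl F0 in auto)
    finally show ?thesis using assms(3) by simp
  qed
  have lower: "F * real j ^ l * real (n div j - l) ^ l \<le> real (I n) * A" for n
  proof -
    \<comment> \<open>The denominator of \<open>F\<close> is only \<open>j ^ (l - 1)\<close>, so the
      extra \<open>j\<close> completes the product to the full number of injections of the
      \<open>r\<close> parts into \<open>j\<close> classes.\<close>
    have "F * real j ^ l = real (\<Prod>i<r. j - i)"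
    proof -
      have "real (\<Prod>i<r. j - i) = (\<Prod>i<r. real j - real i)"
        unfolding of_nat_prod using j by (intro prod.cong) auto
      also have "\<dots> = real j * (\<Prod>i\<in>{1..<r}. real j - real i)"
        using prod.atLeast_Suc_lessThan[of 0 r "\<lambda>i. real j - real i"] rl
        by (simp add: lessThan_atLeast0)
      finally show ?thesis
        using rl j by (cases l) (auto simp: F_def f_rl_def)
    qed
    then have "F * real j ^ l * real (n div j - l) ^ l
        = real ((\<Prod>i<length a. j - i) * (n div j - sum_list a) ^ sum_list a)"
      using assms(1,3) by simp
    also have "\<dots> \<le> real (card (embeddings a {..<n} (turan_edges j n)))"
      using card_embeddings_turan_ge[OF j(3) a1] by (simp only: of_nat_le_iff)
    also have "\<dots> \<le> real (I n * A)"
      using I_max_ge[OF is_graph_turan turan_clique_free[OF j(3,2)], of "cmp_verts a" "cmp_edges a" n]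
      by (simp only: card_embeddings[OF finite_lessThan] A_def I_def of_nat_le_iff mult_le_mono1)
    finally show ?thesis by simp
  qed
  have "(\<lambda>n. real (I n) * A / real n ^ l) \<longlonglongrightarrow> F"
  proof (rule tendsto_sandwich)
    have "(\<lambda>n. F * real j ^ l * (real (n div j - l) ^ l / real n ^ l)) \<longlonglongrightarrow> F * real j ^ l * (1 / real j) ^ l"
      by (intro tendsto_intros div_power_ratio_tendsto j)
    then show "(\<lambda>n. F * real j ^ l * (real (n div j - l) ^ l / real n ^ l)) \<longlonglongrightarrow> F"
      using j by (simp add: power_one_over)
    show "eventually (\<lambda>n. F * real j ^ l * (real (n div j - l) ^ l / real n ^ l)
        \<le> real (I n) * A / real n ^ l) sequentially"
    proof (intro always_eventually allI)
      fix n
      show "F * real j ^ l * (real (n div j - l) ^ l / real n ^ l) \<le> real (I n) * A / real n ^ l"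
        using divide_right_mono[OF lower[of n], of "real n ^ l"] by simp
    qed
    show "eventually (\<lambda>n. real (I n) * A / real n ^ l \<le> F) sequentially"
      using eventually_gt_at_top[of 0]
      by eventually_elim (use upper in \<open>simp add: divide_le_eq\<close>)
  qed simp
  \<comment> \<open>The normalisation \<open>n ^ l\<close> is exchanged for
    \<open>n choose l\<close>, which brings in the limit \<open>fact l\<close>, and the
    automorphisms are divided out.\<close>
  then have "(\<lambda>n. real (I n) * A / real n ^ l * (real n ^ l / real (n choose l)) / A) \<longlonglongrightarrow> F * fact l / A"
    using A by (intro tendsto_intros power_over_choose_tendsto) auto
  moreover have "eventually (\<lambda>n. real (I n) * A / real n ^ l * (real n ^ l / real (n choose l)) / A
      = real (I n) / real (n choose l)) sequentially"
    using eventually_gt_at_top[of 0] by eventually_elim (use A in simp)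
  ultimately have "(\<lambda>n. real (I n) / real (n choose l)) \<longlonglongrightarrow> F * fact l / A"
    by (rule Lim_transform_eventually)
  then show ?thesis unfolding lim I_def by simp
qed

end
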